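(* Let $K$ be a field and $S=K[x_1,\ldots,x_n]$ the standard graded polynomial ring. Let $(I_k)_{k\ge 0}$ and $(J_k)_{k\ge 0}$ be two families of graded ideals of $S$ with $I_0=J_0=S$, $J_k\subset I_k$ for all $k$, $J_kJ_\ell\subset J_{k+\ell}$ and $I_kI_\ell\subset I_{k+\ell}$ for all $k,\ell$, and such that the graded $S$-algebras $A=\bigoplus_{k\ge 0}J_k$ and $B=\bigoplus_{k\ge 0}I_k$ are finitely generated. Then the numerical function $k\mapsto e_0(I_k/J_k)$ is of quasi-polynomial type, i.e. there exist an integer $g\ge 1$ and polynomials $P_0,\ldots,P_{g-1}\in\mathbb{Q}[x]$ such that $e_0(I_{mg+i}/J_{mg+i})=P_i(m)$ for all $m\gg 0$ and $i=0,\ldots,g-1$.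
   Context: For a finitely generated graded $S$-module $N$ of dimension $d$, put $H(N,i)=\sum_{j\le i}\dim_K N_j$; for $i\gg 0$ this agrees with a polynomial of degree $d$, written $P_N(x)=\sum_{i=0}^{d}(-1)^i e_i(N)\binom{x+d-i}{d-i}$, and $e_0(N)$ is the multiplicity of $N$ (with $e_0(0)=0$). *)

theory Defs
  imports "HOL-Library.Poly_Mapping" "HOL-Computational_Algebra.Polynomial"
begin

text \<open>
  The ring $S = K[x_1,\ldots,x_n]$ is the monoid algebra of the exponent vectors
  \<^typ>\<open>'n \<Rightarrow>\<^sub>0 nat\<close> over the field \<^typ>\<open>'k\<close>; the variables are indexed by the finite type
  \<^typ>\<open>'n\<close>, so that $n$ is the cardinality of this type.
\<close>

type_synonym ('n, 'k) mpol = "('n \<Rightarrow>\<^sub>0 nat) \<Rightarrow>\<^sub>0 'k"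

definition mon_deg :: "('n::finite \<Rightarrow>\<^sub>0 nat) \<Rightarrow> nat" where
  "mon_deg m = (\<Sum>v\<in>UNIV. Poly_Mapping.lookup m v)"

definition homog_part :: "nat \<Rightarrow> ('n::finite, 'k::field) mpol set" where
  "homog_part j = {f. \<forall>m\<in>Poly_Mapping.keys f. mon_deg m = j}"

definition homog_comp :: "nat \<Rightarrow> ('n::finite, 'k::field) mpol \<Rightarrow> ('n, 'k) mpol" where
  "homog_comp j f =
     (\<Sum>m\<in>{m \<in> Poly_Mapping.keys f. mon_deg m = j}.
        Poly_Mapping.single m (Poly_Mapping.lookup f m))"

definition smul :: "'k::field \<Rightarrow> ('n::finite, 'k) mpol \<Rightarrow> ('n, 'k) mpol" where
  "smul c f = Poly_Mapping.single 0 c * f"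


section \<open>Ideals\<close>

definition is_ideal :: "'a::comm_ring_1 set \<Rightarrow> bool" where
  "is_ideal I \<longleftrightarrow> module.subspace (*) I"

definition is_prime_ideal :: "'a::comm_ring_1 set \<Rightarrow> bool" where
  "is_prime_ideal P \<longleftrightarrow>
     is_ideal P \<and> P \<noteq> UNIV \<and> (\<forall>a b. a * b \<in> P \<longrightarrow> a \<in> P \<or> b \<in> P)"

definition ideal_prod :: "'a::comm_ring_1 set \<Rightarrow> 'a set \<Rightarrow> 'a set" where
  "ideal_prod I J = module.span (*) {f * g | f g. f \<in> I \<and> g \<in> J}"

definition graded_ideal :: "('n::finite, 'k::field) mpol set \<Rightarrow> bool" where
  "graded_ideal I \<longleftrightarrow> is_ideal I \<and> (\<forall>f\<in>I. \<forall>j. homog_comp j f \<in> I)"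


section \<open>The algebra of a family of ideals\<close>

text \<open>
  For a family of ideals $I_k$ with $I_0 = S$ and $I_k I_l \subseteq I_{k+l}$, the direct sum
  of the $I_k$ is the $S$-subalgebra of $S[t]$ consisting of the polynomials whose coefficient
  of $t^k$ lies in $I_k$.
\<close>

definition family_algebra :: "(nat \<Rightarrow> 'a::comm_ring_1 set) \<Rightarrow> 'a poly set" where
  "family_algebra I = {p. \<forall>k. poly.coeff p k \<in> I k}"

inductive_set subalgebra_gen :: "'a::comm_ring_1 poly set \<Rightarrow> 'a poly set"
  for X :: "'a poly set" where
  scalar: "[:c:] \<in> subalgebra_gen X"
| gen: "p \<in> X \<Longrightarrow> p \<in> subalgebra_gen X"
| add: "p \<in> subalgebra_gen X \<Longrightarrow> q \<in> subalgebra_gen X \<Longrightarrow> p + q \<in> subalgebra_gen X"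
| mult: "p \<in> subalgebra_gen X \<Longrightarrow> q \<in> subalgebra_gen X \<Longrightarrow> p * q \<in> subalgebra_gen X"

definition fin_gen_algebra :: "'a::comm_ring_1 poly set \<Rightarrow> bool" where
  "fin_gen_algebra A \<longleftrightarrow> (\<exists>X. finite X \<and> X \<subseteq> A \<and> subalgebra_gen X = A)"


section \<open>Hilbert coefficients of the module $I/J$\<close>

text \<open>
  In this section a pair of graded ideals $J \subseteq I$ stands for the graded
  $S$-module $N = I/J$, with $N_j = I_j/J_j$.

  A finite set $B \subseteq U$ is a basis of the quotient $U/W$ of $K$-subspaces of $S$ when
  every element of $U$ is congruent modulo $W$ to exactly one $K$-linear combination of $B$.
\<close>

definition is_quot_basis ::
  "('n::finite, 'k::field) mpol set \<Rightarrow> ('n, 'k) mpol set \<Rightarrow> ('n, 'k) mpol set \<Rightarrow> bool" where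
  "is_quot_basis U W B \<longleftrightarrow> finite B \<and> B \<subseteq> U \<and>
     (\<forall>u\<in>U. \<exists>!c. (\<forall>b. b \<notin> B \<longrightarrow> c b = 0) \<and> u - (\<Sum>b\<in>B. smul (c b) b) \<in> W)"

definition quot_dim :: "('n::finite, 'k::field) mpol set \<Rightarrow> ('n, 'k) mpol set \<Rightarrow> nat" where
  "quot_dim U W = (THE r. \<exists>B. is_quot_basis U W B \<and> card B = r)"

definition hilbert_sum ::
  "('n::finite, 'k::field) mpol set \<Rightarrow> ('n, 'k) mpol set \<Rightarrow> nat \<Rightarrow> nat" where
  "hilbert_sum I J i = (\<Sum>j\<le>i. quot_dim (I \<inter> homog_part j) (J \<inter> homog_part j))"

definition quot_annihilator :: "'a::comm_ring_1 set \<Rightarrow> 'a set \<Rightarrow> 'a set" where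
  "quot_annihilator I J = {f. \<forall>g\<in>I. f * g \<in> J}"

text \<open>
  The Krull dimension of $I/J$, that is, of the ring $S/\mathrm{Ann}(I/J)$.  The supremum is taken
  in the natural numbers; the chains of primes in a polynomial ring in finitely many variables
  over a field have bounded length.
\<close>

definition quot_krull_dim ::
  "('n::finite, 'k::field) mpol set \<Rightarrow> ('n, 'k) mpol set \<Rightarrow> nat" where
  "quot_krull_dim I J =
     Sup {r. \<exists>P :: nat \<Rightarrow> ('n, 'k) mpol set.
            (\<forall>i\<le>r. is_prime_ideal (P i) \<and> quot_annihilator I J \<subseteq> P i) \<and>
            (\<forall>i<r. P i \<subset> P (Suc i))}"

definition hilbert_poly ::
  "('n::finite, 'k::field) mpol set \<Rightarrow> ('n, 'k) mpol set \<Rightarrow> rat poly" where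
  "hilbert_poly I J =
     (THE P. \<forall>\<^sub>F i in sequentially. of_nat (hilbert_sum I J i) = poly P (of_nat i))"

text \<open>
  The coefficients $e_i(N)$ in
  $P_N(x) = \sum_{i=0}^{d} (-1)^i e_i(N) \binom{x+d-i}{d-i}$ with $d = \dim N$, extended by
  zero for $i > d$.
\<close>

definition hilbert_coeff ::
  "('n::finite, 'k::field) mpol set \<Rightarrow> ('n, 'k) mpol set \<Rightarrow> nat \<Rightarrow> rat" where
  "hilbert_coeff I J =
     (let d = quot_krull_dim I J in
      THE e. (\<forall>i>d. e i = 0) \<and>
        (\<forall>x. poly (hilbert_poly I J) x =
          (\<Sum>i\<le>d. (-1) ^ i * e i * ((x + of_nat (d - i)) gchoose (d - i)))))"

definition multiplicity_quot ::
  "('n::finite, 'k::field) mpol set \<Rightarrow> ('n, 'k) mpol set \<Rightarrow> rat" where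
  "multiplicity_quot I J = (if I = J then 0 else hilbert_coeff I J 0)"


section \<open>Numerical functions of quasi-polynomial type\<close>

definition quasi_polynomial_type :: "(nat \<Rightarrow> rat) \<Rightarrow> bool" where
  "quasi_polynomial_type h \<longleftrightarrow>
     (\<exists>g\<ge>1. \<exists>P :: nat \<Rightarrow> rat poly. \<forall>\<^sub>F m in sequentially.
        \<forall>i<g. h (m * g + i) = poly (P i) (of_nat m))"

end

theory Submission
  imports Defs "HOL-Library.List_Lexorder"
begin

text \<open>
  Choose homogeneous generators of the algebras $\bigoplus I_k$ and $\bigoplus J_k$. In each
  bidegree the products of generators that are not linear combinations of lexicographically smaller
  products of the same bidegree form a basis, and their exponent vectors form a set closed under
  passing to smaller vectors. Slicing such a set along one coordinate, where the slices stabilise by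
  Dickson's lemma, shows that the Hilbert polynomial of $I_k$ has coefficients that are
  quasi-polynomials in $k$. The same then holds for $I_k/J_k$.

  Which coefficient is the multiplicity depends on the dimension of $I_k/J_k$. For a suitable $L$ and
  all large $N$ one has $I_{N+L} = I_L I_N$ and $J_{N+L} = J_L J_N$, whence the annihilators
  $\mathfrak a_N$ of $I_N/J_N$ satisfy $\mathfrak a_N^2 \subseteq \mathfrak a_{N+L}$. So the support
  shrinks along each residue class modulo $L$, and the set of lengths of chains of primes in it, a
  decreasing sequence of initial segments of the natural numbers, is eventually constant. No
  comparison of the Krull dimension with the degree of the Hilbert polynomial is needed.
\<close>

section \<open>Quasi-polynomials\<close>

text \<open>The obstacle is that \<open>hilbert_coeff\<close> reads the Hilbert polynomial at the
  degree \<open>quot_krull_dim\<close>, which is defined by chains of primes. On a residue class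
  modulo a common period, the coefficients of the Hilbert polynomials are eventually polynomials
  \<open>p c\<close> in the class index, and the dimension is eventually a constant
  \<open>d\<close>. If \<open>p c = 0\<close> for all \<open>c > d\<close>, the leading Hilbert
  coefficient is \<open>d!\<close> times the coefficient of degree \<open>d\<close>. Otherwise some
  \<open>p c\<close> with \<open>c > d\<close> has finitely many zeros, so eventually the definite
  description has no solution and its value is the same for all ideals. Both cases give a polynomial
  on the class.

  The slicing of exponent sets plays the role of a rational generating series with one denominator
  factor \<open>1 - s^a t^d\<close> per generator of bidegree \<open>(a, d)\<close>. Variables have
  bidegree \<open>(0, 1)\<close> and are divided out along the internal degree \<open>i\<close>,
  which yields polynomials in \<open>i\<close>. All other generators have \<open>a > 0\<close> and
  are divided out along the family degree \<open>k\<close>, which yields coefficients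
  quasi-polynomial in \<open>k\<close>.\<close>

lemma poly_eqI_eventually:
  fixes p q :: "rat poly"
  assumes "\<forall>\<^sub>F i in sequentially. poly p (of_nat i) = poly q (of_nat i)"
  shows "p = q"
proof -
  obtain N where N: "\<And>i. i \<ge> N \<Longrightarrow> poly p (of_nat i) = poly q (of_nat i)"
    using assms by (auto simp: eventually_sequentially)
  have "infinite ((of_nat :: nat \<Rightarrow> rat) ` {N..})"
    by (simp add: finite_image_iff inj_on_def infinite_Ici)
  moreover have "(of_nat :: nat \<Rightarrow> rat) ` {N..} \<subseteq> {x. poly (p - q) x = 0}"
    using N by auto
  ultimately have "infinite {x. poly (p - q) x = 0}"
    using finite_subset by blast
  then have "p - q = 0"
    using poly_roots_finite by blast
  then show ?thesis by simp
qed

lemma poly_eventually_nonzero: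
  fixes p :: "rat poly"
  assumes "p \<noteq> 0"
  shows "\<forall>\<^sub>F i in sequentially. poly p (of_nat i) \<noteq> 0"
proof -
  have "finite {i :: nat. poly p (of_nat i) = 0}"
    using finite_vimageI[OF poly_roots_finite[OF assms], of "of_nat :: nat \<Rightarrow> rat"]
    by (simp add: vimage_def inj_on_def)
  then show ?thesis
    by (simp add: cofinite_eq_sequentially[symmetric] eventually_cofinite)
qed

text \<open>A preimage of $x^n$ is obtained from $x^{n+1}/(n+1)$ by correcting lower-order terms.\<close>

lemma poly_antidifference:
  fixes p :: "rat poly"
  shows "\<exists>q. \<forall>x. poly q (x + 1) - poly q x = poly p x"
proof (induction "degree p" arbitrary: p rule: less_induct)
  case less
  define n where "n = degree p"
  define c where "c = lead_coeff p / of_nat (Suc n)"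
  define u where "u = monom c (Suc n)"
  define v where "v = pcompose u [:1, 1:] - u"
  have u: "poly u x = c * x ^ Suc n" for x by (simp add: u_def poly_monom)
  have poly_v: "poly v x = poly u (x + 1) - poly u x" for x
    by (simp add: v_def poly_pcompose add.commute)
  have "poly v x = (\<Sum>k\<le>n. c * of_nat (Suc n choose k) * x ^ k)" for x
  proof -
    have "(x + 1) ^ Suc n = (\<Sum>k\<le>Suc n. of_nat (Suc n choose k) * x ^ k)"
      using binomial_ring[of x 1 "Suc n"] by simp
    then show ?thesis
      unfolding poly_v u
      by (simp only: sum.atMost_Suc binomial_n_n of_nat_1 mult_1 distrib_left sum_distrib_left mult.assoc)
  qed
  then have v: "v = (\<Sum>k\<le>n. monom (c * of_nat (Suc n choose k)) k)"
    by (intro poly_eqI_eventually) (simp add: poly_sum poly_monom)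
  have coeff_v: "coeff v k = (if k \<le> n then c * of_nat (Suc n choose k) else 0)" for k
    by (simp add: v coeff_sum)
  have top: "coeff v n = coeff p n"
    by (simp add: coeff_v c_def n_def del: of_nat_Suc)
  have deg: "degree (p - v) \<le> n"
    by (rule degree_le) (auto simp: coeff_v n_def coeff_eq_0)
  show ?case
  proof (cases "n = 0")
    case True
    then have "p - v = 0"
      using top deg by (intro poly_eqI) (metis coeff_0 coeff_diff coeff_eq_0 diff_self le_zero_eq not_gr_zero)
    then show ?thesis using poly_v by (metis eq_iff_diff_eq_0)
  next
    case False
    have "degree (p - v) < n"
      using deg top False
      by (metis coeff_diff diff_self le_neq_implies_less leading_coeff_0_iff degree_0 neq0_conv)
    then obtain q where q: "\<And>x. poly q (x + 1) - poly q x = poly (p - v) x"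
      using less.hyps n_def by blast
    have "poly (q + u) (x + 1) - poly (q + u) x = poly p x" for x
      using q[of x] by (simp add: poly_v)
    then show ?thesis by blast
  qed
qed

text \<open>After subtraction of a polynomial antidifference of \<open>p\<close>, the function
  \<open>h\<close> is constant from \<open>N\<close> on; \<open>c\<close> is that constant.\<close>

lemma eventually_poly_if_difference:
  fixes h :: "nat \<Rightarrow> rat"
  assumes "\<forall>\<^sub>F m in sequentially. h (Suc m) - h m = poly p (of_nat m)"
  shows "\<exists>q. \<forall>\<^sub>F m in sequentially. h m = poly q (of_nat m)"
proof -
  obtain q where q: "\<And>x. poly q (x + 1) - poly q x = poly p x"
    using poly_antidifference by blast
  obtain N where N: "\<And>m. m \<ge> N \<Longrightarrow> h (Suc m) - h m = poly p (of_nat m)"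
    using assms by (auto simp: eventually_sequentially)
  define c where "c = h N - poly q (of_nat N)"
  have "h m = poly (q + [:c:]) (of_nat m)" if "m \<ge> N" for m
    using that
  proof (induction m rule: dec_induct)
    case base
    show ?case by (simp add: c_def)
  next
    case (step m)
    then show ?case using N[of m] q[of "of_nat m"] by (simp add: add.commute)
  qed
  then show ?thesis unfolding eventually_sequentially by blast
qed

definition qp_period :: "nat \<Rightarrow> (nat \<Rightarrow> rat) \<Rightarrow> bool" where
  "qp_period g h \<longleftrightarrow>
     (\<forall>i. \<exists>p. \<forall>\<^sub>F m in sequentially. h (m * g + i) = poly p (of_nat m))"

lemma qp_periodD:
  assumes "qp_period g h"
  obtains p where "\<forall>\<^sub>F m in sequentially. h (m * g + i) = poly p (of_nat m)"
  using assms by (auto simp: qp_period_def)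

text \<open>Only finitely many residues are involved, so their thresholds merge into one.\<close>

lemma quasi_polynomial_type_if_residues:
  assumes "g \<ge> 1"
    and "\<And>i. i < g \<Longrightarrow> \<exists>p. \<forall>\<^sub>F m in sequentially. h (m * g + i) = poly p (of_nat m)"
  shows "quasi_polynomial_type h"
proof -
  obtain P where P: "\<And>i. i < g \<Longrightarrow> \<forall>\<^sub>F m in sequentially. h (m * g + i) = poly (P i) (of_nat m)"
    using assms(2) by metis
  have "\<forall>\<^sub>F m in sequentially. \<forall>i\<in>{..<g}. h (m * g + i) = poly (P i) (of_nat m)"
    using P by (intro eventually_ball_finite) auto
  then show ?thesis
    using assms(1) unfolding quasi_polynomial_type_def lessThan_iff Ball_def by blast
qed

lemma qp_period_mult:
  assumes "qp_period g h" "c \<ge> 1"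
  shows "qp_period (g * c) h"
  unfolding qp_period_def
proof
  fix i
  obtain p where p: "\<forall>\<^sub>F m in sequentially. h (m * g + i) = poly p (of_nat m)"
    using assms(1) by (rule qp_periodD)
  have "filterlim (\<lambda>m. m * c) sequentially sequentially"
    using assms(2) by (intro filterlim_subseq) (auto simp: strict_mono_def)
  from eventually_compose_filterlim[OF p this]
  have "\<forall>\<^sub>F m in sequentially. h (m * (g * c) + i) = poly (pcompose p [:0, of_nat c:]) (of_nat m)"
    by (simp add: poly_pcompose ac_simps)
  then show "\<exists>p. \<forall>\<^sub>F m in sequentially. h (m * (g * c) + i) = poly p (of_nat m)" by blast
qed

lemma qp_period_add:
  assumes "qp_period g a" "qp_period g b"
  shows "qp_period g (\<lambda>k. a k + b k)"
  unfolding qp_period_def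
proof
  fix i
  obtain p q where "\<forall>\<^sub>F m in sequentially. a (m * g + i) = poly p (of_nat m)"
    "\<forall>\<^sub>F m in sequentially. b (m * g + i) = poly q (of_nat m)"
    using assms unfolding qp_period_def by metis
  then have "\<forall>\<^sub>F m in sequentially. a (m * g + i) + b (m * g + i) = poly (p + q) (of_nat m)"
    by eventually_elim simp
  then show "\<exists>p. \<forall>\<^sub>F m in sequentially. a (m * g + i) + b (m * g + i) = poly p (of_nat m)" by blast
qed

lemma qp_period_cmult:
  assumes "qp_period g a"
  shows "qp_period g (\<lambda>k. c * a k)"
  unfolding qp_period_def
proof
  fix i
  obtain p where "\<forall>\<^sub>F m in sequentially. a (m * g + i) = poly p (of_nat m)"
    using assms by (rule qp_periodD)
  then have "\<forall>\<^sub>F m in sequentially. c * a (m * g + i) = poly (smult c p) (of_nat m)"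
    by eventually_elim simp
  then show "\<exists>p. \<forall>\<^sub>F m in sequentially. c * a (m * g + i) = poly p (of_nat m)" by blast
qed

lemma qp_period_shift:
  assumes "qp_period g h"
  shows "qp_period g (\<lambda>k. h (k + c))"
  using assms unfolding qp_period_def by (simp add: add.assoc)

lemma qp_period_unshift:
  assumes "qp_period g (\<lambda>k. h (k + c))" "g \<ge> 1"
  shows "qp_period g h"
  unfolding qp_period_def
proof
  fix i
  \<comment> \<open>The offset is chosen so that the argument equals \<open>(m + c) * g + i\<close>.
    The translation of \<open>m\<close> by \<open>c\<close> is then undone by composing
    \<open>p\<close> with \<open>x - c\<close>.\<close>
  obtain p where p: "\<forall>\<^sub>F m in sequentially. h (m * g + (i + (c * g - c)) + c) = poly p (of_nat m)"
    using assms(1) by (rule qp_periodD)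
  have "c \<le> c * g" using assms(2) by simp
  then have e: "h (m * g + (i + (c * g - c)) + c) = h ((m + c) * g + i)" for m
    by (intro arg_cong[where f = h]) (unfold add_mult_distrib, linarith)
  have "\<forall>\<^sub>F m in sequentially. h ((m + c) * g + i) = poly (pcompose p [:- of_nat c, 1:]) (of_nat (m + c))"
    using p unfolding e by eventually_elim (simp add: poly_pcompose)
  then have "\<forall>\<^sub>F m in sequentially. h (m * g + i) = poly (pcompose p [:- of_nat c, 1:]) (of_nat m)"
    unfolding eventually_sequentially_seg[where P = "\<lambda>m. h (m * g + i) = poly (pcompose p [:- of_nat c, 1:]) (of_nat m)"] .
  then show "\<exists>p. \<forall>\<^sub>F m in sequentially. h (m * g + i) = poly p (of_nat m)" by blast
qed

lemma qp_period_sum: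
  assumes "finite A" "\<And>x. x \<in> A \<Longrightarrow> qp_period g (a x)"
  shows "qp_period g (\<lambda>k. \<Sum>x\<in>A. a x k)"
  using assms
proof (induction A rule: finite_induct)
  case empty
  then show ?case by (auto simp: qp_period_def intro!: exI[of _ 0])
next
  case (insert x A)
  then show ?case by (simp add: qp_period_add)
qed

definition is_qp :: "(nat \<Rightarrow> rat) \<Rightarrow> bool" where
  "is_qp h \<longleftrightarrow> (\<exists>g\<ge>1. qp_period g h)"

lemma is_qp_add:
  assumes "is_qp a" "is_qp b"
  shows "is_qp (\<lambda>k. a k + b k)"
proof -
  obtain g g' where "g \<ge> 1" "qp_period g a" "g' \<ge> 1" "qp_period g' b"
    using assms by (auto simp: is_qp_def)
  then have "qp_period (g * g') (\<lambda>k. a k + b k)"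
    using qp_period_mult[of g a g'] qp_period_mult[of g' b g]
    by (intro qp_period_add) (auto simp: mult.commute)
  moreover have "g * g' \<ge> 1" using \<open>g \<ge> 1\<close> \<open>g' \<ge> 1\<close> by simp
  ultimately show ?thesis unfolding is_qp_def by blast
qed

lemma is_qp_cmult: "is_qp a \<Longrightarrow> is_qp (\<lambda>k. c * a k)"
  unfolding is_qp_def using qp_period_cmult by blast

lemma is_qp_zero [simp]: "is_qp (\<lambda>k. 0)"
  unfolding is_qp_def qp_period_def by (intro exI[of _ 1] conjI allI exI[of _ 0]) auto

lemma is_qp_sum:
  assumes "finite A" "\<And>x. x \<in> A \<Longrightarrow> is_qp (a x)"
  shows "is_qp (\<lambda>k. \<Sum>x\<in>A. a x k)"
  using assms by (induction A rule: finite_induct) (auto intro: is_qp_add)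

lemma is_qp_shift: "is_qp h \<Longrightarrow> is_qp (\<lambda>k. h (k + c))"
  unfolding is_qp_def using qp_period_shift by blast

lemma is_qp_unshift: "is_qp (\<lambda>k. h (k + c)) \<Longrightarrow> is_qp h"
  unfolding is_qp_def using qp_period_unshift by blast

text \<open>If \<open>g\<close> is a period of the increments over distance \<open>K\<close>, then
  \<open>g\<close> of them telescope to the increment over distance \<open>g * K\<close>, which has
  period \<open>g * K\<close>. On a residue class modulo \<open>g * K\<close> this is a difference
  equation with polynomial right-hand side.\<close>

lemma is_qp_recurrence:
  assumes "is_qp (\<lambda>k. b (k + K) - b k)" "K \<ge> 1"
  shows "is_qp b"
proof -
  define a where "a = (\<lambda>k. b (k + K) - b k)"
  obtain g where g: "g \<ge> 1" "qp_period g a"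
    using assms(1) by (auto simp: is_qp_def a_def)
  have "qp_period (g * K) (\<lambda>k. \<Sum>s<g. a (k + s * K))"
    using g(2) assms(2) by (intro qp_period_sum qp_period_shift qp_period_mult) auto
  moreover have "(\<Sum>s<r. a (k + s * K)) = b (k + r * K) - b k" for k r
    by (induction r) (auto simp: a_def add.assoc add.commute[of "_ * K" K])
  ultimately have diff: "qp_period (g * K) (\<lambda>k. b (k + g * K) - b k)" by simp
  have "qp_period (g * K) b"
    unfolding qp_period_def
  proof
    fix i
    obtain p where "\<forall>\<^sub>F m in sequentially. b (m * (g * K) + i + g * K) - b (m * (g * K) + i) = poly p (of_nat m)"
      using diff by (rule qp_periodD)
    then have "\<forall>\<^sub>F m in sequentially. b (Suc m * (g * K) + i) - b (m * (g * K) + i) = poly p (of_nat m)"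
      by (simp only: mult_Suc add.commute add.left_commute)
    then show "\<exists>p. \<forall>\<^sub>F m in sequentially. b (m * (g * K) + i) = poly p (of_nat m)"
      by (rule eventually_poly_if_difference)
  qed
  then show ?thesis
    using g(1) assms(2) unfolding is_qp_def by (intro exI[of _ "g * K"]) auto
qed

section \<open>Two-parameter Hilbert functions and division by \<open>1 - s^a t^d\<close>\<close>

section \<open>Families of Hilbert functions\<close>

text \<open>Multiplication of the generating series in \<open>s\<close> and \<open>t\<close> by
  \<open>s^a t^d\<close>. Solving \<open>H = F + shift2 a d H\<close> for \<open>H\<close> therefore
  means dividing by \<open>1 - s^a t^d\<close>.\<close>

definition shift2 :: "nat \<Rightarrow> nat \<Rightarrow> (nat \<Rightarrow> nat \<Rightarrow> rat) \<Rightarrow> nat \<Rightarrow> nat \<Rightarrow> rat" where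
  "shift2 a d F k i = (if a \<le> k \<and> d \<le> i then F (k - a) (i - d) else 0)"

text \<open>In the intended use \<open>F k i\<close> is the dimension of the part of degree at most \<open>i\<close> of the
  \<open>k\<close>-th ideal of a family.\<close>

definition qp_hilbert :: "(nat \<Rightarrow> nat \<Rightarrow> rat) \<Rightarrow> (nat \<Rightarrow> rat poly) \<Rightarrow> nat \<Rightarrow> bool" where
  "qp_hilbert F P D \<longleftrightarrow> (\<forall>k. degree (P k) \<le> D) \<and>
     (\<forall>k. \<forall>\<^sub>F i in sequentially. F k i = poly (P k) (of_nat i)) \<and>
     (\<forall>c. is_qp (\<lambda>k. coeff (P k) c))"

lemma eventually_shift_poly:
  fixes p :: "rat poly"
  assumes "\<forall>\<^sub>F i in sequentially. f i = poly p (of_nat i)"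
  shows "\<forall>\<^sub>F i in sequentially. d \<le> i \<and> f (i - d) = poly (pcompose p [:- of_nat d, 1:]) (of_nat i)"
proof -
  obtain N where N: "\<And>i. i \<ge> N \<Longrightarrow> f i = poly p (of_nat i)"
    using assms by (auto simp: eventually_sequentially)
  have "d \<le> i \<and> f (i - d) = poly (pcompose p [:- of_nat d, 1:]) (of_nat i)" if "i \<ge> N + d" for i
    using that N[of "i - d"] by (simp add: poly_pcompose of_nat_diff)
  then show ?thesis unfolding eventually_sequentially by blast
qed

text \<open>Translation acts on coefficient vectors by a unipotent triangular matrix that does not
  depend on \<open>p\<close>. Quasi-polynomiality in \<open>k\<close> of the coefficients of a
  family therefore survives it.\<close>

lemma coeff_pcompose_shift:
  fixes p :: "rat poly"
  assumes "degree p \<le> D"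
  shows "coeff (pcompose p [:- a, 1:]) c =
    coeff p c + (\<Sum>j\<in>{c<..D}. coeff ([:- a, 1:] ^ j) c * coeff p j)"
proof -
  have deg: "degree ([:- a, 1:] ^ j) = j" for j
    by (simp add: degree_linear_power)
  have top: "coeff ([:- a, 1:] ^ j) j = 1" for j
    using deg[of j] by (metis lead_coeff_power lead_coeff_pCons(1) lead_coeff_1 one_pCons pCons_0_0
        power_one zero_neq_one)
  have "p = (\<Sum>j\<le>D. monom (coeff p j) j)"
    using assms by (simp add: poly_as_sum_of_monoms')
  then have "poly p y = (\<Sum>j\<le>D. coeff p j * y ^ j)" for y
    by (metis (no_types, lifting) poly_sum poly_monom sum.cong)
  then have "pcompose p [:- a, 1:] = (\<Sum>j\<le>D. smult (coeff p j) ([:- a, 1:] ^ j))"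
    by (intro poly_eqI_eventually) (simp add: poly_pcompose poly_sum)
  then have "coeff (pcompose p [:- a, 1:]) c = (\<Sum>j\<le>D. coeff ([:- a, 1:] ^ j) c * coeff p j)"
    by (simp add: coeff_sum mult.commute)
  also have "\<dots> = (\<Sum>j\<in>{..D} \<inter> {c..}. coeff ([:- a, 1:] ^ j) c * coeff p j)"
    by (rule sum.mono_neutral_right) (use deg in \<open>auto dest: le_degree\<close>)
  also have "\<dots> = coeff p c + (\<Sum>j\<in>{c<..D}. coeff ([:- a, 1:] ^ j) c * coeff p j)"
  proof (cases "c \<le> D")
    case True
    then have "{..D} \<inter> {c..} = insert c {c<..D}" by auto
    then show ?thesis by (simp add: top)
  next
    case False
    then have "{..D} \<inter> {c..} = {}" "{c<..D} = {}" by auto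
    then show ?thesis using False assms by (simp add: coeff_eq_0)
  qed
  finally show ?thesis .
qed

text \<open>The coefficients of the polynomials of \<open>H\<close> are treated in order of decreasing degree, since
  translation by \<open>d\<close> changes a coefficient only by a combination of higher ones.\<close>

lemma qp_hilbert_recurrence:
  assumes F: "qp_hilbert F P D"
    and H: "\<And>k i. H k i = F k i + shift2 a d H k i"
    and "a \<ge> 1"
  shows "\<exists>Q. qp_hilbert H Q D"
proof -
  have "\<exists>q. degree q \<le> D \<and> (\<forall>\<^sub>F i in sequentially. H k i = poly q (of_nat i))" for k
  proof (induction k rule: less_induct)
    case (less k)
    have Fk: "\<forall>\<^sub>F i in sequentially. F k i = poly (P k) (of_nat i)" and dk: "degree (P k) \<le> D"
      using F by (auto simp: qp_hilbert_def)
    show ?case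
    proof (cases "a \<le> k")
      case False
      then show ?thesis using Fk dk H by (auto simp: shift2_def)
    next
      case True
      then obtain q where q: "degree q \<le> D" "\<forall>\<^sub>F i in sequentially. H (k - a) i = poly q (of_nat i)"
        using less.IH[of "k - a"] \<open>a \<ge> 1\<close> by auto
      have "\<forall>\<^sub>F i in sequentially. H k i = poly (P k + pcompose q [:- of_nat d, 1:]) (of_nat i)"
        using Fk eventually_shift_poly[OF q(2), of d] unfolding H[of k]
        by eventually_elim (simp add: shift2_def True)
      moreover have "degree (P k + pcompose q [:- of_nat d, 1:]) \<le> D"
        using dk q(1) by (intro degree_add_le) (auto simp: degree_pcompose)
      ultimately show ?thesis by blast
    qed
  qed
  then obtain Q where Q: "\<And>k. degree (Q k) \<le> D"
    "\<And>k. \<forall>\<^sub>F i in sequentially. H k i = poly (Q k) (of_nat i)"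
    by metis
  have rec: "Q (k + a) = P (k + a) + pcompose (Q k) [:- of_nat d, 1:]" for k
  proof (rule poly_eqI_eventually)
    have "\<forall>\<^sub>F i in sequentially. F (k + a) i = poly (P (k + a)) (of_nat i)"
      using F by (auto simp: qp_hilbert_def)
    then show "\<forall>\<^sub>F i in sequentially. poly (Q (k + a)) (of_nat i) =
        poly (P (k + a) + pcompose (Q k) [:- of_nat d, 1:]) (of_nat i)"
      using Q(2)[of "k + a"] eventually_shift_poly[OF Q(2)[of k], of d]
      by eventually_elim (use H[of "k + a"] in \<open>simp add: shift2_def\<close>)
  qed
  have "is_qp (\<lambda>k. coeff (Q k) c)" for c
  proof (induction "Suc D - c" arbitrary: c rule: less_induct)
    case less
    show ?case
    proof (cases "c \<le> D")
      case False
      then have "coeff (Q k) c = 0" for k using Q(1)[of k] by (simp add: coeff_eq_0)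
      then show ?thesis by simp
    next
      case True
      let ?l = "\<lambda>j. coeff ([:- of_nat d, 1:] ^ j) c :: rat"
      have "coeff (Q (k + a)) c - coeff (Q k) c =
          coeff (P (k + a)) c + (\<Sum>j\<in>{c<..D}. ?l j * coeff (Q k) j)" for k
        using coeff_pcompose_shift[OF Q(1)[of k], of "of_nat d" c] by (simp add: rec)
      moreover have "is_qp (\<lambda>k. coeff (P (k + a)) c + (\<Sum>j\<in>{c<..D}. ?l j * coeff (Q k) j))"
      proof (intro is_qp_add is_qp_sum is_qp_cmult)
        show "is_qp (\<lambda>k. coeff (P (k + a)) c)"
          using F by (intro is_qp_shift[of "\<lambda>k. coeff (P k) c"]) (auto simp: qp_hilbert_def)
        show "is_qp (\<lambda>k. coeff (Q k) j)" if "j \<in> {c<..D}" for j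
          using that True by (intro less.hyps) auto
      qed simp
      ultimately have "is_qp (\<lambda>k. coeff (Q (k + a)) c - coeff (Q k) c)" by simp
      then show ?thesis using \<open>a \<ge> 1\<close> by (rule is_qp_recurrence)
    qed
  qed
  then show ?thesis using Q unfolding qp_hilbert_def by blast
qed

lemma qp_hilbert_add:
  assumes "qp_hilbert F P D" "qp_hilbert F' P' D'"
  shows "qp_hilbert (\<lambda>k i. F k i + F' k i) (\<lambda>k. P k + P' k) (max D D')"
  unfolding qp_hilbert_def
proof (intro conjI allI)
  fix k c
  show "degree (P k + P' k) \<le> max D D'"
    using assms unfolding qp_hilbert_def by (meson degree_add_le le_max_iff_disj)
  have "\<forall>\<^sub>F i in sequentially. F k i = poly (P k) (of_nat i)"
    "\<forall>\<^sub>F i in sequentially. F' k i = poly (P' k) (of_nat i)"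
    using assms by (auto simp: qp_hilbert_def)
  then show "\<forall>\<^sub>F i in sequentially. F k i + F' k i = poly (P k + P' k) (of_nat i)"
    by eventually_elim simp
  show "is_qp (\<lambda>k. coeff (P k + P' k) c)"
    using assms by (auto simp: qp_hilbert_def intro: is_qp_add)
qed

lemma qp_hilbert_uminus:
  assumes "qp_hilbert F P D"
  shows "qp_hilbert (\<lambda>k i. - F k i) (\<lambda>k. - P k) D"
  using assms is_qp_cmult[of _ "- 1"] unfolding qp_hilbert_def by simp

lemma qp_hilbert_shift:
  assumes "qp_hilbert F P D"
  shows "\<exists>Q. qp_hilbert (shift2 a d F) Q D"
proof -
  define Q where "Q k = (if a \<le> k then pcompose (P (k - a)) [:- of_nat d, 1:] else 0)" for k
  have deg: "degree (P k) \<le> D" for k using assms by (simp add: qp_hilbert_def)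
  have "degree (Q k) \<le> D" for k
    using deg by (simp add: Q_def degree_pcompose)
  moreover have "\<forall>\<^sub>F i in sequentially. shift2 a d F k i = poly (Q k) (of_nat i)" for k
  proof (cases "a \<le> k")
    case True
    have "\<forall>\<^sub>F i in sequentially. F (k - a) i = poly (P (k - a)) (of_nat i)"
      using assms by (auto simp: qp_hilbert_def)
    from eventually_shift_poly[OF this, of d] show ?thesis
      by eventually_elim (simp add: shift2_def Q_def True)
  qed (simp add: shift2_def Q_def)
  moreover have "is_qp (\<lambda>k. coeff (Q k) c)" for c
  proof (rule is_qp_unshift[where c = a])
    have "is_qp (\<lambda>k. coeff (P k) c + (\<Sum>j\<in>{c<..D}. coeff ([:- of_nat d, 1:] ^ j) c * coeff (P k) j))"
      using assms by (intro is_qp_add is_qp_sum is_qp_cmult) (auto simp: qp_hilbert_def)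
    then show "is_qp (\<lambda>k. coeff (Q (k + a)) c)"
      using deg by (simp add: Q_def coeff_pcompose_shift[of _ D])
  qed
  ultimately show ?thesis unfolding qp_hilbert_def by blast
qed

definition is_qp_hilbert :: "(nat \<Rightarrow> nat \<Rightarrow> rat) \<Rightarrow> bool" where
  "is_qp_hilbert F \<longleftrightarrow> (\<exists>P D. qp_hilbert F P D)"

text \<open>Meant for counts over the variables alone, whose products all have family degree 0. With
  \<open>a = 0\<close> the recurrence does not lower \<open>k\<close> and has to be solved in
  \<open>i\<close>.\<close>

definition is_poly_hilbert :: "(nat \<Rightarrow> nat \<Rightarrow> rat) \<Rightarrow> bool" where
  "is_poly_hilbert F \<longleftrightarrow> (\<forall>k i. k > 0 \<longrightarrow> F k i = 0) \<and>
     (\<exists>p. \<forall>\<^sub>F i in sequentially. F 0 i = poly p (of_nat i))"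

lemma is_qp_hilbert_if_poly:
  assumes "is_poly_hilbert F"
  shows "is_qp_hilbert F"
proof -
  obtain p where p: "\<forall>\<^sub>F i in sequentially. F 0 i = poly p (of_nat i)"
    and z: "\<And>k i. k > 0 \<Longrightarrow> F k i = 0"
    using assms by (auto simp: is_poly_hilbert_def)
  \<comment> \<open>A shift by one discards the only value that can be nonzero.\<close>
  have "is_qp (\<lambda>k. coeff (if k = 0 then p else 0) c)" for c
    by (rule is_qp_unshift[where c = 1]) simp
  then have "qp_hilbert F (\<lambda>k. if k = 0 then p else 0) (degree p)"
    using p z by (auto simp: qp_hilbert_def)
  then show ?thesis unfolding is_qp_hilbert_def by blast
qed

text \<open>At \<open>k = 0\<close> this is a first-order difference equation in \<open>i\<close>.
  The step 1, the degree of a variable, makes the solution a true polynomial; a larger step would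
  only give a quasi-polynomial in \<open>i\<close>.\<close>

lemma is_poly_hilbert_recurrence:
  assumes "is_poly_hilbert F"
    and H: "\<And>k i. H k i = F k i + shift2 0 1 H k i"
  shows "is_poly_hilbert H"
proof -
  obtain p where p: "\<forall>\<^sub>F i in sequentially. F 0 i = poly p (of_nat i)"
    and z: "\<And>k i. k > 0 \<Longrightarrow> F k i = 0"
    using assms by (auto simp: is_poly_hilbert_def)
  have "H k i = 0" if "k > 0" for k i
    using that by (induction i) (simp_all add: H[of k] z shift2_def)
  moreover have "\<forall>\<^sub>F i in sequentially. F 0 (Suc i) = poly p (of_nat (Suc i))"
    using p unfolding eventually_sequentially_Suc[where P = "\<lambda>i. F 0 i = poly p (of_nat i)"] .
  then have "\<forall>\<^sub>F i in sequentially. H 0 (Suc i) - H 0 i = poly (pcompose p [:1, 1:]) (of_nat i)"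
    by eventually_elim (use H[of 0] in \<open>simp add: shift2_def poly_pcompose\<close>)
  then have "\<exists>q. \<forall>\<^sub>F i in sequentially. H 0 i = poly q (of_nat i)"
    by (rule eventually_poly_if_difference)
  ultimately show ?thesis by (simp add: is_poly_hilbert_def)
qed

lemma is_poly_hilbert_add_shift:
  assumes "is_poly_hilbert F" "is_poly_hilbert H"
  shows "is_poly_hilbert (\<lambda>k i. F k i + shift2 0 1 H k i)"
proof -
  obtain p q where p: "\<forall>\<^sub>F i in sequentially. F 0 i = poly p (of_nat i)"
    and q: "\<forall>\<^sub>F i in sequentially. H 0 i = poly q (of_nat i)"
    using assms by (auto simp: is_poly_hilbert_def)
  have "\<forall>\<^sub>F i in sequentially. F 0 i + shift2 0 1 H 0 i = poly (p + pcompose q [:- of_nat 1, 1:]) (of_nat i)"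
    using p eventually_shift_poly[OF q, of 1]
    by eventually_elim (simp add: shift2_def)
  moreover have "F k i + shift2 0 1 H k i = 0" if "k > 0" for k i
    using assms that by (auto simp: is_poly_hilbert_def shift2_def)
  ultimately show ?thesis unfolding is_poly_hilbert_def by blast
qed

section \<open>Dickson's lemma and the slicing of order ideals of exponent vectors\<close>

section \<open>Counting exponent vectors\<close>

text \<open>\<open>P n\<close> says that \<open>f n\<close> is minimal among all later values. A
  minimum exists on every tail, so there are infinitely many such \<open>n\<close>, and
  \<open>f\<close> is nondecreasing along them.\<close>

lemma nat_seq_mono_subseq:
  fixes f :: "nat \<Rightarrow> nat"
  shows "\<exists>r :: nat \<Rightarrow> nat. strict_mono r \<and> (\<forall>i j. i \<le> j \<longrightarrow> f (r i) \<le> f (r j))"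
proof -
  define P where "P n = (\<forall>j\<ge>n. f n \<le> f j)" for n
  have ex: "\<exists>n>m. P n" for m
  proof -
    define n where "n = (ARG_MIN f n. n > m)"
    have "n > m" "\<And>j. j > m \<Longrightarrow> f n \<le> f j"
      using arg_min_nat_lemma[of "\<lambda>n. n > m" "Suc m" f] by (auto simp: n_def)
    then show ?thesis by (auto simp: P_def)
  qed
  then have inf: "infinite {n. P n}"
    by (metis infinite_nat_iff_unbounded mem_Collect_eq)
  define r where "r = enumerate {n. P n}"
  have "strict_mono r" unfolding r_def by (rule strict_mono_enumerate[OF inf])
  moreover have "P (r i)" for i
    using enumerate_in_set[OF inf, of i] by (simp add: r_def)
  ultimately show ?thesis
    unfolding P_def by (intro exI[of _ r]) (simp add: strict_mono_less_eq)
qed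

text \<open>Dickson's lemma in sequence form: a subsequence monotone in the tails is refined to one
  that is monotone in the heads as well.\<close>

lemma dickson_mono_subseq:
  fixes f :: "nat \<Rightarrow> nat list"
  assumes "\<And>i. length (f i) = n"
  shows "\<exists>r :: nat \<Rightarrow> nat. strict_mono r \<and> (\<forall>i j. i \<le> j \<longrightarrow> list_all2 (\<le>) (f (r i)) (f (r j)))"
  using assms
proof (induction n arbitrary: f)
  case 0
  then show ?case by (intro exI[of _ id]) (auto simp: strict_mono_def)
next
  case (Suc n)
  have "\<exists>r :: nat \<Rightarrow> nat. strict_mono r \<and> (\<forall>i j. i \<le> j \<longrightarrow> list_all2 (\<le>) (tl (f (r i))) (tl (f (r j))))"
    using Suc.prems by (intro Suc.IH[of "\<lambda>i. tl (f i)"]) simp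
  then obtain r :: "nat \<Rightarrow> nat" where r: "strict_mono r"
    "\<And>i j. i \<le> j \<Longrightarrow> list_all2 (\<le>) (tl (f (r i))) (tl (f (r j)))"
    by blast
  obtain s :: "nat \<Rightarrow> nat" where s: "strict_mono s" "\<And>i j. i \<le> j \<Longrightarrow> hd (f (r (s i))) \<le> hd (f (r (s j)))"
    using nat_seq_mono_subseq[of "\<lambda>i. hd (f (r i))"] by blast
  have cons: "hd (f i) # tl (f i) = f i" for i
    using Suc.prems[of i] by (cases "f i") auto
  have "list_all2 (\<le>) (f (r (s i))) (f (r (s j)))" if "i \<le> j" for i j
  proof -
    have "s i \<le> s j" using that s(1) by (simp add: strict_mono_less_eq)
    then have "list_all2 (\<le>) (hd (f (r (s i))) # tl (f (r (s i)))) (hd (f (r (s j))) # tl (f (r (s j))))"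
      using s(2)[OF that] r(2) by simp
    then show ?thesis by (simp only: cons)
  qed
  then show ?case
    using r(1) s(1) by (intro exI[of _ "\<lambda>i. r (s i)"]) (simp add: strict_mono_def)
qed

definition down_closed :: "nat list set \<Rightarrow> bool" where
  "down_closed C \<longleftrightarrow> (\<forall>u v. list_all2 (\<le>) u v \<longrightarrow> v \<in> C \<longrightarrow> u \<in> C)"

text \<open>If the chain never stabilised, each \<open>C s\<close> would contain some
  \<open>v s\<close> that is lost by stage \<open>g s\<close>. Along a monotone subsequence,
  \<open>v (r 0)\<close> lies below some \<open>v (r j)\<close> with
  \<open>r j \<ge> g (r 0)\<close>, so it would still belong to \<open>C (g (r 0))\<close>.\<close>

lemma down_closed_chain_stable:
  assumes "\<And>t. down_closed (C t)" "\<And>t. C (Suc t) \<subseteq> C t"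
    and "\<And>t v. v \<in> C t \<Longrightarrow> length v = n"
  shows "\<exists>s. \<forall>t\<ge>s. C t = C s"
proof (rule ccontr)
  have dec: "C t \<subseteq> C s" if "s \<le> t" for s t
    using lift_Suc_antimono_le[of C, OF assms(2) that] .
  assume "\<nexists>s. \<forall>t\<ge>s. C t = C s"
  then have "\<forall>s. \<exists>t. t \<ge> s \<and> (\<exists>v. v \<in> C s \<and> v \<notin> C t)"
    using dec by blast
  then obtain g v where gv: "\<And>s. g s \<ge> s" "\<And>s. v s \<in> C s" "\<And>s. v s \<notin> C (g s)"
    by metis
  have "length (v s) = n" for s using gv(2) assms(3) by blast
  from dickson_mono_subseq[of v, OF this] obtain r :: "nat \<Rightarrow> nat"
    where r: "strict_mono r" "\<And>i j. i \<le> j \<Longrightarrow> list_all2 (\<le>) (v (r i)) (v (r j))"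
    by blast
  define j where "j = max 0 (g (r 0))"
  have "g (r 0) \<le> r j" using seq_suble[OF r(1), of j] by (simp add: j_def)
  then have "v (r j) \<in> C (g (r 0))" using gv(2) dec by blast
  moreover have "list_all2 (\<le>) (v (r 0)) (v (r j))" using r(2) by simp
  ultimately have "v (r 0) \<in> C (g (r 0))" using assms(1) unfolding down_closed_def by blast
  then show False using gv(3) by blast
qed

text \<open>A generator of bidegree \<open>(a, d)\<close> is recorded as \<open>(a, d, f)\<close>, with \<open>f\<close> homogeneous of degree
  \<open>d\<close> in the \<open>a\<close>-th ideal; a list of natural numbers is the exponent vector of a product of
  generators.\<close>

type_synonym 'a gens = "(nat \<times> nat \<times> 'a) list"

fun fam_deg :: "'a gens \<Rightarrow> nat list \<Rightarrow> nat" where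
  "fam_deg ((a, d, f) # G) (t # e) = t * a + fam_deg G e"
| "fam_deg _ _ = 0"

fun int_deg :: "'a gens \<Rightarrow> nat list \<Rightarrow> nat" where
  "int_deg ((a, d, f) # G) (t # e) = t * d + int_deg G e"
| "int_deg _ _ = 0"

text \<open>Exact in the family degree but cumulative in the internal degree, to match
  \<open>hilbert_sum\<close>.\<close>

definition bounded_exps :: "'a gens \<Rightarrow> nat list set \<Rightarrow> nat \<Rightarrow> nat \<Rightarrow> nat list set" where
  "bounded_exps G C k i = {e \<in> C. length e = length G \<and> fam_deg G e = k \<and> int_deg G e \<le> i}"

definition exp_count :: "'a gens \<Rightarrow> nat list set \<Rightarrow> nat \<Rightarrow> nat \<Rightarrow> rat" where
  "exp_count G C k i = of_nat (card (bounded_exps G C k i))"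

lemma exp_le_degs:
  assumes "\<forall>(a, d, f)\<in>set G. a + d > 0" "length e = length G"
  shows "set e \<subseteq> {..fam_deg G e + int_deg G e}"
  using assms
proof (induction G e rule: fam_deg.induct)
  case (1 a d f G t e)
  have "t \<le> t * a + t * d"
    using 1(2) by (cases a; cases d) auto
  moreover have "set e \<subseteq> {..fam_deg G e + int_deg G e}" using 1 by auto
  ultimately have "t \<le> t * a + fam_deg G e + (t * d + int_deg G e)"
    "set e \<subseteq> {..t * a + fam_deg G e + (t * d + int_deg G e)}"
    by (auto simp: subset_iff intro: trans_le_add1)
  then show ?case by simp
qed auto

lemma finite_bounded_exps:
  assumes "\<forall>(a, d, f)\<in>set G. a + d > 0"
  shows "finite (bounded_exps G C k i)"
proof (rule finite_subset)
  show "bounded_exps G C k i \<subseteq> {e. set e \<subseteq> {..k + i} \<and> length e = length G}"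
    using exp_le_degs[OF assms] by (fastforce simp: bounded_exps_def)
qed (simp add: finite_lists_length_eq)

text \<open>Vectors with first exponent 0 are counted over \<open>G\<close>. From the others one
  copy of the first generator is removed, which lowers the bidegree by
  \<open>(a, d)\<close>.\<close>

lemma exp_count_Cons:
  assumes "\<forall>(a, d, f)\<in>set ((a, d, f) # G). a + d > 0"
  shows "exp_count ((a, d, f) # G) C k i = exp_count G {v. 0 # v \<in> C} k i +
    shift2 a d (exp_count ((a, d, f) # G) {t # v |t v. Suc t # v \<in> C}) k i"
proof -
  let ?G = "(a, d, f) # G" and ?C = "{t # v |t v. Suc t # v \<in> C}"
  define A where "A = (#) 0 ` bounded_exps G {v. 0 # v \<in> C} k i"
  define inc :: "nat list \<Rightarrow> nat list" where "inc e = Suc (hd e) # tl e" for e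
  define B where "B = (if a \<le> k \<and> d \<le> i then inc ` bounded_exps ?G ?C (k - a) (i - d) else {})"
  have "bounded_exps ?G C k i = A \<union> B"
  proof (intro equalityI subsetI)
    fix e assume e: "e \<in> bounded_exps ?G C k i"
    then obtain t v where tv: "e = t # v" "length v = length G"
      by (cases e) (auto simp: bounded_exps_def)
    show "e \<in> A \<union> B"
    proof (cases t)
      case 0
      then show ?thesis using e tv by (auto simp: bounded_exps_def A_def)
    next
      case (Suc s)
      then have "a \<le> k" "d \<le> i" "s # v \<in> bounded_exps ?G ?C (k - a) (i - d)"
        using e tv by (auto simp: bounded_exps_def)
      then have "inc (s # v) \<in> B" by (simp add: B_def)
      then show ?thesis using Suc tv by (simp add: inc_def)
    qed
  next
    fix e assume "e \<in> A \<union> B"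
    then show "e \<in> bounded_exps ?G C k i"
      by (auto simp: A_def B_def inc_def bounded_exps_def split: if_splits)
  qed
  moreover have "A \<inter> B = {}" by (auto simp: A_def B_def inc_def)
  moreover have "finite A"
    using assms by (simp add: A_def finite_bounded_exps)
  moreover have "finite B"
    using finite_bounded_exps[OF assms] by (simp add: B_def)
  moreover have "card A = card (bounded_exps G {v. 0 # v \<in> C} k i)"
    unfolding A_def by (rule card_image) (simp add: inj_on_def)
  moreover have "card (inc ` bounded_exps ?G ?C (k - a) (i - d)) = card (bounded_exps ?G ?C (k - a) (i - d))"
    by (rule card_image) (auto simp: inj_on_def bounded_exps_def inc_def)
  ultimately show ?thesis
    by (simp add: exp_count_def shift2_def card_Un_disjoint B_def)
qed

text \<open>The slices \<open>E s\<close> at first exponent \<open>s\<close> decrease and stabilise.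
  At the stable index the remaining part \<open>D s\<close> satisfies a recurrence in itself, which
  \<open>recur\<close> solves; finitely many uses of \<open>add\<close> then put back the earlier
  slices. The property \<open>\<Phi>\<close> is abstract because the scheme is run once for the
  variables and once for the generators of positive family degree.\<close>

lemma exp_count_slice_induct:
  assumes G: "\<forall>(a, d, f)\<in>set ((a, d, f) # G). a + d > 0"
    and tail: "\<And>C. down_closed C \<Longrightarrow> \<Phi> (exp_count G C)"
    and add: "\<And>F H. \<Phi> F \<Longrightarrow> \<Phi> H \<Longrightarrow> \<Phi> (\<lambda>k i. F k i + shift2 a d H k i)"
    and recur: "\<And>F H. \<Phi> F \<Longrightarrow> (\<And>k i. H k i = F k i + shift2 a d H k i) \<Longrightarrow> \<Phi> H"
    and C: "down_closed C"
  shows "\<Phi> (exp_count ((a, d, f) # G) C)"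
proof -
  let ?G = "(a, d, f) # G"
  define D where "D s = {t # v |t v. (t + s) # v \<in> C}" for s
  \<comment> \<open>The length condition is what allows Dickson's lemma to be applied to the
    slices.\<close>
  define E where "E s = {v. s # v \<in> C \<and> length v = length G}" for s
  have E_down: "down_closed (E s)" for s
    unfolding down_closed_def E_def mem_Collect_eq
  proof (intro allI impI conjI)
    fix u v assume uv: "list_all2 (\<le>) u v" and v: "s # v \<in> C \<and> length v = length G"
    have "list_all2 (\<le>) (s # u) (s # v)" using uv by simp
    then show "s # u \<in> C" using C v unfolding down_closed_def by blast
    show "length u = length G" using uv v by (simp add: list_all2_lengthD)
  qed
  have "E (Suc s) \<subseteq> E s" for s
  proof
    fix v assume v: "v \<in> E (Suc s)"
    have "list_all2 (\<le>) (s # v) (Suc s # v)" by (simp add: list_all2_refl)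
    then show "v \<in> E s" using C v unfolding down_closed_def E_def by blast
  qed
  then have "\<exists>s. \<forall>t\<ge>s. E t = E s"
    using E_down by (intro down_closed_chain_stable[where n = "length G"]) (auto simp: E_def)
  then obtain s where s: "\<And>t. t \<ge> s \<Longrightarrow> E t = E s" by blast
  have restrict: "exp_count G {v. 0 # v \<in> D r} = exp_count G (E r)" for r
    by (intro ext) (auto simp: exp_count_def bounded_exps_def D_def E_def intro!: arg_cong[where f = card])
  have step: "exp_count ?G (D r) k i = exp_count G (E r) k i + shift2 a d (exp_count ?G (D (Suc r))) k i"
    for r k i
  proof -
    have "{t # v |t v. Suc t # v \<in> D r} = D (Suc r)" by (auto simp: D_def)
    then show ?thesis using exp_count_Cons[OF G, of "D r" k i] by (simp add: restrict)
  qed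
  \<comment> \<open>Beyond the stable index another shift changes no count, so \<open>step\<close>
    at \<open>s\<close> has the same function on both sides.\<close>
  have stable: "exp_count ?G (D (Suc s)) = exp_count ?G (D s)"
  proof -
    have "(t + Suc s) # v \<in> C \<longleftrightarrow> (t + s) # v \<in> C" if "length v = length G" for t v
      using s[of "t + Suc s"] s[of "t + s"] that by (auto simp: E_def)
    then have "bounded_exps ?G (D (Suc s)) = bounded_exps ?G (D s)"
      by (intro ext) (auto simp: bounded_exps_def D_def)
    then show ?thesis by (intro ext) (simp add: exp_count_def)
  qed
  have "\<Phi> (exp_count ?G (D s))"
    using tail[OF E_down[of s]] by (rule recur) (use step[of s] stable in simp)
  then have "\<Phi> (exp_count ?G (D (s - r)))" for r
  proof (induction r)
    case (Suc r)
    show ?case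
    proof (cases "r < s")
      case True
      then have "Suc (s - Suc r) = s - r" by simp
      then have "exp_count ?G (D (s - Suc r)) =
          (\<lambda>k i. exp_count G (E (s - Suc r)) k i + shift2 a d (exp_count ?G (D (s - r))) k i)"
        using step[of "s - Suc r"] by (intro ext) simp
      then show ?thesis
        using add[OF tail[OF E_down[of "s - Suc r"]] Suc.IH[OF Suc.prems]] by simp
    qed (use Suc in simp)
  qed simp
  from this[of s] have "\<Phi> (exp_count ?G (D 0))" by simp
  moreover have "exp_count ?G (D 0) = exp_count ?G C"
  proof -
    have "bounded_exps ?G (D 0) = bounded_exps ?G C"
      by (intro ext) (auto simp: bounded_exps_def D_def length_Suc_conv)
    then show ?thesis by (intro ext) (simp add: exp_count_def)
  qed
  ultimately show ?thesis by simp
qed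

lemma is_poly_hilbert_exp_count:
  fixes G :: "'a gens"
  assumes "\<forall>(a, d, f)\<in>set G. a = 0 \<and> d = 1" "down_closed C"
  shows "is_poly_hilbert (exp_count G C)"
  using assms
proof (induction G arbitrary: C)
  case Nil
  have "bounded_exps ([] :: 'a gens) C k i = (if [] \<in> C \<and> k = 0 then {[]} else {})" for k i
    by (auto simp: bounded_exps_def)
  then have "exp_count ([] :: 'a gens) C k i = (if k = 0 then poly [:if [] \<in> C then 1 else 0:] (of_nat i) else 0)" for k i
    by (auto simp: exp_count_def)
  then show ?case
    unfolding is_poly_hilbert_def by (intro conjI exI[of _ "[:if [] \<in> C then 1 else 0:]"]) simp_all
next
  case (Cons g G)
  obtain f where g: "g = (0, 1, f)" using Cons.prems(1) by (cases g) auto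
  show ?case unfolding g
  proof (rule exp_count_slice_induct[where \<Phi> = is_poly_hilbert])
    show "\<forall>(a, d, f)\<in>set ((0, 1, f) # G). 0 < a + d" using Cons.prems(1) by auto
    show "is_poly_hilbert (exp_count G C)" if "down_closed C" for C
      using Cons.IH[of C] Cons.prems that by auto
    show "is_poly_hilbert H" if "is_poly_hilbert F" "\<And>k i. H k i = F k i + shift2 0 1 H k i" for F H
      using that by (rule is_poly_hilbert_recurrence)
  qed (use Cons.prems is_poly_hilbert_add_shift in simp_all)
qed

text \<open>The variables stand at the end of the list and form the base case. Every generator added
  in front has \<open>a > 0\<close>, so its recurrence descends in \<open>k\<close>.\<close>

lemma is_qp_hilbert_exp_count:
  assumes "\<forall>(a, d, f)\<in>set Y. a > 0" "\<forall>(a, d, f)\<in>set X. a = 0 \<and> d = 1" "down_closed C"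
  shows "is_qp_hilbert (exp_count (Y @ X) C)"
  using assms
proof (induction Y arbitrary: C)
  case Nil
  then show ?case by (simp add: is_qp_hilbert_if_poly is_poly_hilbert_exp_count)
next
  case (Cons g Y)
  obtain a d f where g: "g = (a, d, f)" by (cases g) auto
  have a: "a \<ge> 1" using Cons.prems(1) g by auto
  show ?case unfolding g append_Cons
  proof (rule exp_count_slice_induct[where \<Phi> = is_qp_hilbert])
    show "\<forall>(a, d, f)\<in>set ((a, d, f) # Y @ X). 0 < a + d" using Cons.prems a by fastforce
    show "is_qp_hilbert (exp_count (Y @ X) C)" if "down_closed C" for C
      using Cons.IH[of C] Cons.prems that by auto
    show "is_qp_hilbert (\<lambda>k i. F k i + shift2 a d H k i)" if FH: "is_qp_hilbert F" "is_qp_hilbert H" for F H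
    proof -
      obtain P D Q E where F: "qp_hilbert F P D" and H: "qp_hilbert H Q E"
        using FH by (auto simp: is_qp_hilbert_def)
      obtain Q' where "qp_hilbert (shift2 a d H) Q' E" using qp_hilbert_shift[OF H] by blast
      from qp_hilbert_add[OF F this] show ?thesis unfolding is_qp_hilbert_def by blast
    qed
    show "is_qp_hilbert H" if FH: "is_qp_hilbert F" "\<And>k i. H k i = F k i + shift2 a d H k i" for F H
    proof -
      obtain P D where F: "qp_hilbert F P D" using FH(1) by (auto simp: is_qp_hilbert_def)
      show ?thesis
        using qp_hilbert_recurrence[OF F FH(2) a] unfolding is_qp_hilbert_def by blast
    qed
  qed (use Cons.prems in auto)
qed

section \<open>Dimensions of quotients\<close>

text \<open>The induction adds elements in increasing order: a new maximum \<open>b\<close> leaves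
  the sets of predecessors of the old elements unchanged, so only the status of \<open>b\<close> has
  to be decided.\<close>

lemma (in vector_space) greedy_basis:
  fixes w :: "'e::linorder \<Rightarrow> 'b"
  assumes "finite E"
  defines "S \<equiv> {e \<in> E. w e \<notin> span (w ` {e' \<in> E. e' < e})}"
  shows "inj_on w S \<and> independent (w ` S) \<and> span (w ` S) = span (w ` E)"
  using assms(1) unfolding S_def
proof (induction E rule: finite_linorder_max_induct)
  case empty
  then show ?case by (simp add: independent_empty)
next
  case (insert b A)
  define S where "S = {e \<in> A. w e \<notin> span (w ` {e' \<in> A. e' < e})}"
  define L where "L e = {e' \<in> insert b A. e' < e}" for e
  define T where "T = {e \<in> insert b A. w e \<notin> span (w ` L e)}"
  have IH: "inj_on w S" "independent (w ` S)" "span (w ` S) = span (w ` A)"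
    using insert.IH unfolding S_def by auto
  have "L b = A" using insert.hyps(2) by (auto simp: L_def)
  moreover have "L a = {e' \<in> A. e' < a}" if "a \<in> A" for a
    using bspec[OF insert.hyps(2) that] by (auto simp: L_def)
  then have "S = {e \<in> A. w e \<notin> span (w ` L e)}"
    unfolding S_def by auto
  ultimately have T: "T = (if w b \<in> span (w ` A) then S else insert b S)"
    unfolding T_def by auto
  have "inj_on w T \<and> independent (w ` T) \<and> span (w ` T) = span (w ` insert b A)"
  proof (cases "w b \<in> span (w ` A)")
    case True
    then show ?thesis using IH by (simp add: T span_redundant)
  next
    case False
    then have *: "w b \<notin> span (w ` S)" using IH by simp
    then have "w b \<notin> w ` S" using span_base by blast
    then have "inj_on w (insert b S)" using IH(1) unfolding inj_on_insert by blast
    moreover have "independent (insert (w b) (w ` S))"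
      using * IH(2) by (simp add: independent_insertI)
    moreover have "span (insert (w b) (w ` S)) = span (insert (w b) (w ` A))"
      using IH(3) by (simp add: span_insert)
    ultimately show ?thesis using False by (simp add: T)
  qed
  then show ?case unfolding T_def L_def .
qed

lemma (in vector_space) dim_span_greedy:
  fixes w :: "'e::linorder \<Rightarrow> 'b"
  assumes "finite E"
  shows "dim (span (w ` E)) = card {e \<in> E. w e \<notin> span (w ` {e' \<in> E. e' < e})}"
  using greedy_basis[OF assms, of w] by (metis (no_types, lifting) card_image dim_eq_card dim_span)

interpretation mpol: vector_space "smul :: 'k::field \<Rightarrow> ('n::finite, 'k) mpol \<Rightarrow> ('n, 'k) mpol"
  by unfold_locales
    (simp_all add: smul_def distrib_left distrib_right single_add mult_single mult.assoc[symmetric])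

text \<open>Uniqueness at \<open>u = 0\<close> gives independence modulo \<open>W\<close>, and
  independence gives uniqueness for every \<open>u\<close> by subtraction. The support condition on
  \<open>c\<close> only normalises the coefficients.\<close>

lemma is_quot_basis_iff:
  assumes "mpol.subspace U" "mpol.subspace W"
  shows "is_quot_basis U W B \<longleftrightarrow> finite B \<and> B \<subseteq> U \<and>
    (\<forall>u\<in>U. \<exists>c. u - (\<Sum>b\<in>B. smul (c b) b) \<in> W) \<and>
    (\<forall>c. (\<Sum>b\<in>B. smul (c b) b) \<in> W \<longrightarrow> (\<forall>b\<in>B. c b = 0))"
    (is "_ \<longleftrightarrow> finite B \<and> B \<subseteq> U \<and> ?ex \<and> ?un")
proof -
  have restrict: "(\<Sum>b\<in>B. smul (if b \<in> B then c b else 0) b) = (\<Sum>b\<in>B. smul (c b) b)" for c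
    by (rule sum.cong) auto
  have "?ex \<and> ?un" if "is_quot_basis U W B"
  proof (intro conjI allI impI ballI)
    fix u assume "u \<in> U"
    then show "\<exists>c. u - (\<Sum>b\<in>B. smul (c b) b) \<in> W"
      using that unfolding is_quot_basis_def by blast
  next
    fix c b assume c: "(\<Sum>b\<in>B. smul (c b) b) \<in> W" and b: "b \<in> B"
    have "\<exists>!c. (\<forall>b. b \<notin> B \<longrightarrow> c b = 0) \<and> 0 - (\<Sum>b\<in>B. smul (c b) b) \<in> W"
      using that mpol.subspace_0[OF assms(1)] unfolding is_quot_basis_def by blast
    moreover have "0 - (\<Sum>b\<in>B. smul (if b \<in> B then c b else 0) b) \<in> W"
      unfolding restrict using mpol.subspace_neg[OF assms(2) c] by simp
    moreover have "0 - (\<Sum>b\<in>B. smul 0 b) \<in> W"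
      using mpol.subspace_0[OF assms(2)] by simp
    ultimately have "(\<lambda>b. if b \<in> B then c b else 0) = (\<lambda>b. 0)" by auto
    then show "c b = 0" using b by (metis (full_types))
  qed
  moreover have "is_quot_basis U W B" if B: "finite B" "B \<subseteq> U" and ex: ?ex and un: ?un
    unfolding is_quot_basis_def
  proof (intro conjI ballI B)
    fix u assume "u \<in> U"
    then obtain c where c: "u - (\<Sum>b\<in>B. smul (c b) b) \<in> W" using ex by blast
    show "\<exists>!c. (\<forall>b. b \<notin> B \<longrightarrow> c b = 0) \<and> u - (\<Sum>b\<in>B. smul (c b) b) \<in> W"
    proof (rule ex_ex1I)
      show "\<exists>c. (\<forall>b. b \<notin> B \<longrightarrow> c b = 0) \<and> u - (\<Sum>b\<in>B. smul (c b) b) \<in> W"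
        using c by (intro exI[of _ "\<lambda>b. if b \<in> B then c b else 0"]) (simp add: restrict)
    next
      fix c c'
      assume c: "(\<forall>b. b \<notin> B \<longrightarrow> c b = 0) \<and> u - (\<Sum>b\<in>B. smul (c b) b) \<in> W"
        and c': "(\<forall>b. b \<notin> B \<longrightarrow> c' b = 0) \<and> u - (\<Sum>b\<in>B. smul (c' b) b) \<in> W"
      have "(\<Sum>b\<in>B. smul (c b - c' b) b) =
          (u - (\<Sum>b\<in>B. smul (c' b) b)) - (u - (\<Sum>b\<in>B. smul (c b) b))"
        by (simp add: mpol.scale_left_diff_distrib sum_subtractf)
      then have "(\<Sum>b\<in>B. smul (c b - c' b) b) \<in> W"
        using mpol.subspace_diff[OF assms(2) conjunct2[OF c'] conjunct2[OF c]] by simp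
      then have "\<forall>b\<in>B. c b - c' b = 0" using un by (elim allE[of _ "\<lambda>b. c b - c' b"]) simp
      then have "c b = c' b" for b using c c' by (cases "b \<in> B") auto
      then show "c = c'" by (rule ext)
    qed
  qed
  ultimately show ?thesis unfolding is_quot_basis_def by blast
qed

text \<open>Any quotient basis together with a basis \<open>A\<close> of \<open>W\<close> is a basis
  of \<open>U\<close>, so all quotient bases have the same size. One exists: extend \<open>A\<close>
  to a basis \<open>C\<close> of \<open>U\<close> and take \<open>C - A\<close>. Hence the
  description in \<open>quot_dim\<close> is well defined.\<close>

lemma dim_eq_quot_dim:
  assumes U: "mpol.subspace U" and W: "mpol.subspace W" and WU: "W \<subseteq> U"
    and S: "finite S" "U \<subseteq> mpol.span S"
  shows "mpol.dim U = mpol.dim W + quot_dim U W"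
proof -
  obtain A where A: "A \<subseteq> W" "mpol.independent A" "W \<subseteq> mpol.span A" "card A = mpol.dim W"
    using mpol.basis_exists[of W] by blast
  have spanA: "mpol.span A = W"
    using mpol.span_minimal[OF A(1) W] A(3) by (rule subset_antisym)
  have finA: "finite A"
    using mpol.independent_span_bound[OF S(1) A(2)] A(1) WU S(2) by blast
  have card: "mpol.dim U = mpol.dim W + card B" if "is_quot_basis U W B" for B
  proof -
    have B: "finite B" "B \<subseteq> U" "\<And>u. u \<in> U \<Longrightarrow> \<exists>c. u - (\<Sum>b\<in>B. smul (c b) b) \<in> W"
      and un: "\<And>c b. (\<Sum>b\<in>B. smul (c b) b) \<in> W \<Longrightarrow> b \<in> B \<Longrightarrow> c b = 0"
      using that unfolding is_quot_basis_iff[OF U W] by blast+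
    have disj: "B \<inter> A = {}"
    proof (rule ccontr)
      assume "B \<inter> A \<noteq> {}"
      then obtain x where x: "x \<in> B" "x \<in> W" using A(1) by blast
      have "(\<Sum>b\<in>B. smul (if b = x then 1 else 0) b) = (\<Sum>b\<in>{x}. smul (if b = x then 1 else 0) b)"
        using x B(1) by (intro sum.mono_neutral_right) auto
      then have "(\<Sum>b\<in>B. smul (if b = x then 1 else 0) b) \<in> W" using x by simp
      from un[OF this x(1)] show False by simp
    qed
    have "mpol.independent (B \<union> A)"
    proof (rule mpol.independent_if_scalars_zero)
      show "finite (B \<union> A)" using B finA by simp
      fix c x assume 0: "(\<Sum>x\<in>B \<union> A. smul (c x) x) = 0" and x: "x \<in> B \<union> A"
      have split: "(\<Sum>x\<in>B. smul (c x) x) + (\<Sum>x\<in>A. smul (c x) x) = 0"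
        using 0 disj B(1) finA by (simp add: sum.union_disjoint)
      have inW: "(\<Sum>x\<in>A. smul (c x) x) \<in> W"
        using A(1) W by (intro mpol.subspace_sum mpol.subspace_scale) auto
      have "(\<Sum>x\<in>B. smul (c x) x) = - (\<Sum>x\<in>A. smul (c x) x)"
        using split by (rule eq_neg_iff_add_eq_0[THEN iffD2])
      then have "(\<Sum>x\<in>B. smul (c x) x) \<in> W"
        using mpol.subspace_neg[OF W inW] by (simp only:)
      then have cB: "\<And>b. b \<in> B \<Longrightarrow> c b = 0" using un by blast
      then have "(\<Sum>x\<in>A. smul (c x) x) = 0" using split by simp
      then have "\<And>b. b \<in> A \<Longrightarrow> c b = 0"
        using mpol.independentD[OF A(2) finA subset_refl] by blast
      then show "c x = 0" using cB x by blast
    qed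
    moreover have "mpol.span (B \<union> A) = U"
    proof
      show "mpol.span (B \<union> A) \<subseteq> U"
        using B(2) A(1) WU U by (intro mpol.span_minimal) auto
      show "U \<subseteq> mpol.span (B \<union> A)"
      proof
        fix u assume "u \<in> U"
        then obtain c where "u - (\<Sum>b\<in>B. smul (c b) b) \<in> W" using B(3) by blast
        then have "u - (\<Sum>b\<in>B. smul (c b) b) \<in> mpol.span (B \<union> A)"
          using spanA mpol.span_mono[of A "B \<union> A"] by blast
        moreover have "(\<Sum>b\<in>B. smul (c b) b) \<in> mpol.span (B \<union> A)"
          by (intro mpol.span_sum mpol.span_scale mpol.span_base) simp
        ultimately have "u - (\<Sum>b\<in>B. smul (c b) b) + (\<Sum>b\<in>B. smul (c b) b) \<in> mpol.span (B \<union> A)"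
          by (rule mpol.span_add)
        then show "u \<in> mpol.span (B \<union> A)" by simp
      qed
    qed
    ultimately have "mpol.dim U = card (B \<union> A)"
      using mpol.dim_eq_card[of "B \<union> A" U] mpol.span_eq_iff[THEN iffD2, OF U] by simp
    then show ?thesis using disj B(1) finA A(4) by (simp add: card_Un_disjoint)
  qed
  obtain C where C: "A \<subseteq> C" "C \<subseteq> U" "mpol.independent C" "U \<subseteq> mpol.span C"
    using mpol.maximal_independent_subset_extend[of A U] A(1,2) WU by blast
  have finC: "finite C"
    using mpol.independent_span_bound[OF S(1) C(3)] C(2) S(2) by blast
  have C_basis: "is_quot_basis U W (C - A)"
    unfolding is_quot_basis_iff[OF U W]
  proof (intro conjI ballI allI impI)
    fix u assume "u \<in> U"
    then obtain c where "u = (\<Sum>b\<in>C. smul (c b) b)"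
      using C(4) mpol.span_finite[OF finC] by auto
    also have "\<dots> = (\<Sum>b\<in>C - A. smul (c b) b) + (\<Sum>b\<in>A. smul (c b) b)"
      using C(1) finC by (simp add: sum.subset_diff)
    finally have "u - (\<Sum>b\<in>C - A. smul (c b) b) = (\<Sum>b\<in>A. smul (c b) b)" by simp
    moreover have "(\<Sum>b\<in>A. smul (c b) b) \<in> W"
      using A(1) W by (intro mpol.subspace_sum mpol.subspace_scale) auto
    ultimately show "\<exists>c. u - (\<Sum>b\<in>C - A. smul (c b) b) \<in> W" by (intro exI[of _ c]) (simp only:)
  next
    fix c b assume c: "(\<Sum>b\<in>C - A. smul (c b) b) \<in> W" and b: "b \<in> C - A"
    then obtain a where a: "(\<Sum>b\<in>C - A. smul (c b) b) = (\<Sum>b\<in>A. smul (a b) b)"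
      using spanA mpol.span_finite[OF finA] by auto
    let ?c = "\<lambda>b. if b \<in> A then - a b else c b"
    have "(\<Sum>b\<in>C. smul (?c b) b) = (\<Sum>b\<in>C - A. smul (?c b) b) + (\<Sum>b\<in>A. smul (?c b) b)"
      using C(1) finC by (simp add: sum.subset_diff)
    also have "\<dots> = (\<Sum>b\<in>C - A. smul (c b) b) + (\<Sum>b\<in>A. - smul (a b) b)"
      by (intro arg_cong2[where f = "(+)"] sum.cong) auto
    also have "\<dots> = 0" using a by (simp add: sum_negf)
    finally have "?c b = 0"
      using mpol.independentD[OF C(3) finC subset_refl, of ?c b] b by simp
    then show "c b = 0" using b by simp
  qed (use finC C in auto)
  have "quot_dim U W = card (C - A)"
    unfolding quot_dim_def
  proof (rule the_equality)
    fix r assume "\<exists>B. is_quot_basis U W B \<and> card B = r"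
    then obtain B where "is_quot_basis U W B" "card B = r" by blast
    then show "r = card (C - A)" using card[of B] card[OF C_basis] by simp
  qed (use C_basis in blast)
  with card[OF C_basis] show ?thesis by simp
qed

section \<open>Graded pieces of the polynomial ring and standard monomials of a presentation\<close>

section \<open>Products of generators\<close>

lemma module_times: "module ((*) :: 'a::comm_ring_1 \<Rightarrow> 'a \<Rightarrow> 'a)"
  by unfold_locales (simp_all add: algebra_simps)

lemma is_ideal_iff:
  "is_ideal I \<longleftrightarrow> 0 \<in> I \<and> (\<forall>x\<in>I. \<forall>y\<in>I. x + y \<in> I) \<and> (\<forall>c. \<forall>x\<in>I. c * x \<in> I)"
  unfolding is_ideal_def module.subspace_def[OF module_times] by blast

lemma ideal_prodI:
  assumes "f \<in> I" "g \<in> J"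
  shows "f * g \<in> ideal_prod I J"
  unfolding ideal_prod_def using assms by (intro module.span_base[OF module_times]) blast

lemma subspace_if_is_ideal:
  assumes "is_ideal I"
  shows "mpol.subspace I"
  using assms unfolding is_ideal_iff mpol.subspace_def smul_def by blast

lemma lookup_smul: "Poly_Mapping.lookup (smul c f) m = c * Poly_Mapping.lookup f m"
  unfolding smul_def mult_map_scale_conv_mult[symmetric] by (simp add: map.rep_eq when_def)

lemma smul_mult_left: "smul c f * g = smul c (f * g)"
  by (simp add: smul_def mult.assoc)

lemma smul_single: "smul c (Poly_Mapping.single m 1) = Poly_Mapping.single m c"
  by (simp add: smul_def mult_single)

lemma lookup_homog_comp:
  "Poly_Mapping.lookup (homog_comp j f) m = (if mon_deg m = j then Poly_Mapping.lookup f m else 0)"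
proof -
  have "Poly_Mapping.lookup (homog_comp j f) m =
      (\<Sum>m'\<in>{m' \<in> Poly_Mapping.keys f. mon_deg m' = j}. if m' = m then Poly_Mapping.lookup f m else 0)"
    unfolding homog_comp_def lookup_sum by (rule sum.cong) (auto simp: lookup_single)
  also have "\<dots> = (if mon_deg m = j then Poly_Mapping.lookup f m else 0)"
    by (auto simp: in_keys_iff)
  finally show ?thesis .
qed

lemma homog_comp_add: "homog_comp j (f + g) = homog_comp j f + homog_comp j g"
  by (rule poly_mapping_eqI) (simp add: lookup_homog_comp lookup_add)

lemma homog_comp_smul: "homog_comp j (smul c f) = smul c (homog_comp j f)"
  by (rule poly_mapping_eqI) (simp add: lookup_homog_comp lookup_smul)

lemma homog_part_iff: "f \<in> homog_part j \<longleftrightarrow> (\<forall>m. mon_deg m \<noteq> j \<longrightarrow> Poly_Mapping.lookup f m = 0)"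
  by (auto simp: homog_part_def in_keys_iff)

lemma homog_comp_in_homog_part: "homog_comp j f \<in> homog_part j"
  by (simp add: homog_part_iff lookup_homog_comp)

lemma homog_comp_homog:
  assumes "f \<in> homog_part i"
  shows "homog_comp j f = (if i = j then f else 0)"
  using assms by (intro poly_mapping_eqI) (auto simp: homog_part_iff lookup_homog_comp)

lemma sum_homog_comp: "f = (\<Sum>j\<in>mon_deg ` Poly_Mapping.keys f. homog_comp j f)"
proof (rule poly_mapping_eqI)
  fix m
  show "Poly_Mapping.lookup f m =
      Poly_Mapping.lookup (\<Sum>j\<in>mon_deg ` Poly_Mapping.keys f. homog_comp j f) m"
    by (auto simp: lookup_sum lookup_homog_comp in_keys_iff)
qed

lemma subspace_homog_part: "mpol.subspace (homog_part j)"
  unfolding mpol.subspace_def by (simp add: homog_part_iff lookup_add lookup_smul)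

lemma mon_deg_add: "mon_deg (m + m') = mon_deg m + mon_deg m'"
  by (simp add: mon_deg_def lookup_add sum.distrib)

lemma homog_part_mult:
  assumes "f \<in> homog_part i" "g \<in> homog_part j"
  shows "f * g \<in> homog_part (i + j)"
  using assms keys_mult[of f g] unfolding homog_part_def by (fastforce simp: mon_deg_add)

lemma one_homog: "1 \<in> homog_part 0"
  by (simp add: homog_part_def mon_deg_def)

lemma homog_part_power:
  assumes "f \<in> homog_part i"
  shows "f ^ t \<in> homog_part (t * i)"
  using assms by (induction t) (auto simp: one_homog intro: homog_part_mult)

lemma sum_monomials:
  "f = (\<Sum>m\<in>Poly_Mapping.keys f. Poly_Mapping.single m (Poly_Mapping.lookup f m))"
proof (rule poly_mapping_eqI)
  fix m
  have "(\<Sum>m'\<in>Poly_Mapping.keys f. Poly_Mapping.lookup (Poly_Mapping.single m' (Poly_Mapping.lookup f m')) m)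
      = (\<Sum>m'\<in>Poly_Mapping.keys f. if m' = m then Poly_Mapping.lookup f m else 0)"
    by (rule sum.cong) (auto simp: lookup_single)
  then show "Poly_Mapping.lookup f m = Poly_Mapping.lookup
      (\<Sum>m\<in>Poly_Mapping.keys f. Poly_Mapping.single m (Poly_Mapping.lookup f m)) m"
    by (auto simp: lookup_sum in_keys_iff)
qed

lemma span_mult_right:
  assumes "x \<in> mpol.span S" "\<And>s. s \<in> S \<Longrightarrow> s * y \<in> mpol.span T"
  shows "x * y \<in> mpol.span T"
proof -
  have "mpol.subspace {x. x * y \<in> mpol.span T}"
    unfolding mpol.subspace_def
    by (auto simp: distrib_right smul_mult_left mpol.span_zero mpol.span_add mpol.span_scale)
  then have "mpol.span S \<subseteq> {x. x * y \<in> mpol.span T}"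
    using assms(2) by (intro mpol.span_minimal) auto
  then show ?thesis using assms(1) by blast
qed

lemma span_mult:
  assumes "x \<in> mpol.span S" "y \<in> mpol.span T" "\<And>s t. s \<in> S \<Longrightarrow> t \<in> T \<Longrightarrow> s * t \<in> mpol.span R"
  shows "x * y \<in> mpol.span R"
proof (rule span_mult_right[OF assms(1)])
  fix s assume s: "s \<in> S"
  have "y * s \<in> mpol.span R"
    using assms(2) by (rule span_mult_right) (simp add: assms(3)[OF s] mult.commute[of _ s])
  then show "s * y \<in> mpol.span R" by (simp add: mult.commute)
qed

fun gen_prod :: "'a::comm_ring_1 gens \<Rightarrow> nat list \<Rightarrow> 'a" where
  "gen_prod ((a, d, f) # G) (t # e) = f ^ t * gen_prod G e"
| "gen_prod _ _ = 1"

lemma map2_add_degs: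
  assumes "length G = length u" "length u = length v"
  shows "fam_deg G (map2 (+) u v) = fam_deg G u + fam_deg G v"
    and "int_deg G (map2 (+) u v) = int_deg G u + int_deg G v"
    and "gen_prod G (map2 (+) u v) = gen_prod G u * gen_prod G v"
  using assms
  by (induction G u v rule: list_induct3) (auto simp: algebra_simps power_add)

text \<open>The compatibility required of a monomial order. With equal lengths no list is a proper
  prefix of another, so the first differing entry decides.\<close>

lemma map2_add_mono:
  fixes u v w :: "nat list"
  assumes "length u = length v" "length v = length w" "u < v"
  shows "map2 (+) u w < map2 (+) v w"
  using assms by (induction u v w rule: list_induct3) auto

lemma fam_deg_zero [simp]: "fam_deg G (replicate (length G) 0) = 0"
  by (induction G) auto

lemma gen_prod_zero [simp]: "gen_prod G (replicate (length G) 0) = 1"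
  by (induction G) auto

lemma gen_exp_exists:
  assumes "(a, d, f) \<in> set G"
  shows "\<exists>e. length e = length G \<and> fam_deg G e = a \<and> gen_prod G e = f"
  using assms
proof (induction G)
  case (Cons g G)
  obtain a' d' f' where g: "g = (a', d', f')" by (cases g) auto
  show ?case
  proof (cases "(a, d, f) = g")
    case True
    then show ?thesis
      using g by (intro exI[of _ "1 # replicate (length G) 0"]) auto
  next
    case False
    then obtain e where "length e = length G" "fam_deg G e = a" "gen_prod G e = f"
      using Cons by auto
    then show ?thesis using g by (intro exI[of _ "0 # e"]) auto
  qed
qed simp

definition fam_exps :: "'a gens \<Rightarrow> nat \<Rightarrow> nat list set" where
  "fam_exps G k = {e. length e = length G \<and> fam_deg G e = k}"

definition bideg_exps :: "'a gens \<Rightarrow> nat \<Rightarrow> nat \<Rightarrow> nat list set" where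
  "bideg_exps G k j = {e. length e = length G \<and> fam_deg G e = k \<and> int_deg G e = j}"

text \<open>The exponents of the standard monomials with respect to the lexicographic order, for the
  kernel of the presentation of the algebra by the generators \<open>G\<close>.\<close>

definition std_exps :: "('n::finite, 'k::field) mpol gens \<Rightarrow> nat list set" where
  "std_exps G = {e. length e = length G \<and> gen_prod G e \<notin>
     mpol.span (gen_prod G ` {e' \<in> bideg_exps G (fam_deg G e) (int_deg G e). e' < e})}"

text \<open>Nonstandard exponents form an upper set: a relation expressing the product for
  \<open>u\<close> through smaller ones of its bidegree, multiplied by the product for
  \<open>r = v - u\<close>, is such a relation for \<open>v\<close>.\<close>

lemma down_closed_std_exps: "down_closed (std_exps G)"
  unfolding down_closed_def
proof (intro allI impI, rule ccontr)
  fix u v assume uv: "list_all2 (\<le>) u v" and v: "v \<in> std_exps G" and u: "u \<notin> std_exps G"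
  define r where "r = map2 (-) v u"
  have len: "length u = length G" "length v = length G" "length r = length G"
    using uv v by (auto simp: std_exps_def r_def dest: list_all2_lengthD)
  have vr: "v = map2 (+) u r"
    using uv unfolding r_def by (induction rule: list_all2_induct) auto
  let ?S = "\<lambda>e. gen_prod G ` {e' \<in> bideg_exps G (fam_deg G e) (int_deg G e). e' < e}"
  have "gen_prod G u \<in> mpol.span (?S u)" using u len by (simp add: std_exps_def)
  moreover have "s * gen_prod G r \<in> mpol.span (?S v)" if s: "s \<in> ?S u" for s
  proof -
    obtain e where e: "s = gen_prod G e" "length e = length G" "fam_deg G e = fam_deg G u"
      "int_deg G e = int_deg G u" "e < u"
      using s by (auto simp: bideg_exps_def)
    have "map2 (+) e r < v" unfolding vr using e len by (intro map2_add_mono) auto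
    moreover have "map2 (+) e r \<in> bideg_exps G (fam_deg G v) (int_deg G v)"
      unfolding vr using e len by (simp add: bideg_exps_def map2_add_degs)
    moreover have "s * gen_prod G r = gen_prod G (map2 (+) e r)"
      using e len by (simp add: map2_add_degs)
    ultimately show ?thesis by (intro mpol.span_base) auto
  qed
  ultimately have "gen_prod G u * gen_prod G r \<in> mpol.span (?S v)" by (rule span_mult_right)
  then have "gen_prod G v \<in> mpol.span (?S v)" using len by (simp add: vr map2_add_degs)
  then show False using v by (simp add: std_exps_def)
qed

lemma finite_bideg_exps:
  assumes "\<forall>(a, d, f)\<in>set G. a + d > 0"
  shows "finite (bideg_exps G k j)"
  using finite_bounded_exps[OF assms, of UNIV k j]
  by (rule rev_finite_subset) (auto simp: bideg_exps_def bounded_exps_def)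

text \<open>In each bidegree the standard exponents are exactly those selected by
  \<open>greedy_basis\<close>, and different internal degrees give disjoint sets.\<close>

lemma sum_dim_bideg:
  fixes G :: "('n::finite, 'k::field) mpol gens"
  assumes "\<forall>(a, d, f)\<in>set G. a + d > 0"
  shows "of_nat (\<Sum>j\<le>i. mpol.dim (mpol.span (gen_prod G ` bideg_exps G k j))) =
    exp_count G (std_exps G) k i"
proof -
  let ?S = "\<lambda>j. {e \<in> std_exps G. e \<in> bideg_exps G k j}"
  have "mpol.dim (mpol.span (gen_prod G ` bideg_exps G k j)) = card (?S j)" for j
  proof -
    have "{e \<in> bideg_exps G k j. gen_prod G e \<notin>
        mpol.span (gen_prod G ` {e' \<in> bideg_exps G k j. e' < e})} = ?S j"
      by (auto simp: std_exps_def bideg_exps_def)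
    then show ?thesis
      using mpol.dim_span_greedy[OF finite_bideg_exps[OF assms], of "gen_prod G" k j] by simp
  qed
  then have "(\<Sum>j\<le>i. mpol.dim (mpol.span (gen_prod G ` bideg_exps G k j))) = (\<Sum>j\<le>i. card (?S j))"
    by simp
  also have "\<dots> = card (\<Union>j\<in>{..i}. ?S j)"
    using finite_bideg_exps[OF assms]
    by (intro card_UN_disjoint[symmetric]) (auto simp: bideg_exps_def)
  also have "(\<Union>j\<in>{..i}. ?S j) = bounded_exps G (std_exps G) k i"
    by (auto simp: bideg_exps_def bounded_exps_def)
  finally show ?thesis by (simp add: exp_count_def)
qed

section \<open>Generators of a family of graded ideals\<close>

text \<open>A span over the field. In its use for ideals the variables occur among the generators
  with family degree 0, which accounts for multiplication by elements of \<open>S\<close>.\<close>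

definition fam_span :: "('n::finite, 'k::field) mpol gens \<Rightarrow> nat \<Rightarrow> ('n, 'k) mpol set" where
  "fam_span G k = mpol.span (gen_prod G ` fam_exps G k)"

lemma subspace_fam_span: "mpol.subspace (fam_span G k)"
  by (simp add: fam_span_def mpol.subspace_span)

lemma fam_span_mult:
  assumes "x \<in> fam_span G k" "y \<in> fam_span G l"
  shows "x * y \<in> fam_span G (k + l)"
  using assms unfolding fam_span_def
proof (rule span_mult)
  fix s t assume "s \<in> gen_prod G ` fam_exps G k" "t \<in> gen_prod G ` fam_exps G l"
  then obtain u v where "s = gen_prod G u" "u \<in> fam_exps G k" "t = gen_prod G v" "v \<in> fam_exps G l"
    by blast
  then have "s * t = gen_prod G (map2 (+) u v)" "map2 (+) u v \<in> fam_exps G (k + l)"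
    by (auto simp: fam_exps_def map2_add_degs)
  then show "s * t \<in> mpol.span (gen_prod G ` fam_exps G (k + l))"
    by (auto intro: mpol.span_base)
qed

lemma fam_span_gen:
  assumes "(a, d, f) \<in> set G"
  shows "f \<in> fam_span G a"
  using gen_exp_exists[OF assms] unfolding fam_span_def fam_exps_def
  by (auto intro!: mpol.span_base)

lemma fam_span_one: "1 \<in> fam_span G 0"
  unfolding fam_span_def
  by (rule mpol.span_base, rule image_eqI[of _ _ "replicate (length G) 0"]) (simp_all add: fam_exps_def)

definition var :: "'n::finite \<Rightarrow> ('n, 'k::field) mpol" where
  "var v = Poly_Mapping.single (Poly_Mapping.single v 1) 1"

lemma var_homog: "var v \<in> homog_part 1"
  by (simp add: var_def homog_part_def mon_deg_def lookup_single when_def)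

lemma fam_span_0_eq_UNIV:
  fixes G :: "('n::finite, 'k::field) mpol gens"
  assumes "\<And>v. (0, 1, var v) \<in> set G"
  shows "fam_span G 0 = UNIV"
proof -
  let ?M = "{m. Poly_Mapping.single m 1 \<in> fam_span G 0}"
  have zero: "0 \<in> ?M" using fam_span_one[of G] by simp
  have add: "m + m' \<in> ?M" if "m \<in> ?M" "m' \<in> ?M" for m m'
  proof -
    have "Poly_Mapping.single m 1 * Poly_Mapping.single m' 1 \<in> fam_span G (0 + 0)"
      using that by (intro fam_span_mult) auto
    then show ?thesis by (simp add: mult_single)
  qed
  have single: "Poly_Mapping.single v t \<in> ?M" for v t
  proof (induction t)
    case (Suc t)
    have "Poly_Mapping.single v 1 \<in> ?M"
      using fam_span_gen[OF assms[of v]] by (simp add: var_def)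
    from add[OF this Suc] show ?case by (simp flip: single_add)
  qed (use zero in simp)
  have mono: "m \<in> ?M" for m :: "'n \<Rightarrow>\<^sub>0 nat"
  proof -
    have "(\<Sum>v\<in>A. Poly_Mapping.single v (Poly_Mapping.lookup m v)) \<in> ?M" if "finite A" for A
      using that by (induction A rule: finite_induct) (use zero add single in auto)
    then show ?thesis using sum_monomials[of m] finite_keys by metis
  qed
  have "f \<in> fam_span G 0" for f
  proof -
    have "(\<Sum>m\<in>Poly_Mapping.keys f. smul (Poly_Mapping.lookup f m) (Poly_Mapping.single m 1)) \<in> fam_span G 0"
      using mono by (intro mpol.subspace_sum[OF subspace_fam_span] mpol.subspace_scale[OF subspace_fam_span]) auto
    then show ?thesis by (simp add: smul_single flip: sum_monomials)
  qed
  then show ?thesis by blast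
qed

locale ideal_family =
  fixes I :: "nat \<Rightarrow> ('n::finite, 'k::field) mpol set"
  assumes graded: "graded_ideal (I k)"
    and zero: "I 0 = UNIV"
    and prod: "ideal_prod (I k) (I l) \<subseteq> I (k + l)"
    and fin_gen: "fin_gen_algebra (family_algebra I)"
begin

lemma ideal: "is_ideal (I k)"
  using graded by (simp add: graded_ideal_def)

lemma zero_mem: "0 \<in> I k"
  using ideal[of k] unfolding is_ideal_iff by blast

lemma mult_mem: "x \<in> I k \<Longrightarrow> y \<in> I l \<Longrightarrow> x * y \<in> I (k + l)"
  using prod[of k l] ideal_prodI[of x "I k" y "I l"] by blast

lemma power_mem: "x \<in> I k \<Longrightarrow> x ^ t \<in> I (t * k)"
  by (induction t) (simp_all add: zero mult_mem)

lemma subspace: "mpol.subspace (I k)"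
  using ideal by (rule subspace_if_is_ideal)

lemma gen_prod_mem:
  assumes "\<forall>(a, d, f)\<in>set G. f \<in> I a"
  shows "gen_prod G e \<in> I (fam_deg G e)"
  using assms by (induction G e rule: gen_prod.induct) (simp_all add: zero mult_mem power_mem)

text \<open>Each algebra generator is replaced by the homogeneous components of its coefficients,
  which stay in the ideals because these are graded. Products of spans lie in spans, so membership
  of all coefficients passes from the generators to the whole algebra; an element \<open>f\<close>
  of \<open>I k\<close> enters as \<open>monom f k\<close>.\<close>

lemma generators_exist:
  "\<exists>Y X. (\<forall>(a, d, f)\<in>set Y. a > 0) \<and> (\<forall>(a, d, f)\<in>set X. a = 0 \<and> d = 1) \<and>
     (\<forall>(a, d, f)\<in>set (Y @ X). f \<in> I a \<and> f \<in> homog_part d) \<and> I = fam_span (Y @ X)"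
proof -
  obtain P where P: "finite P" "P \<subseteq> family_algebra I" "subalgebra_gen P = family_algebra I"
    using fin_gen unfolding fin_gen_algebra_def by blast
  \<comment> \<open>Starting at \<open>k = 1\<close> ensures positive family degrees in
    \<open>Y\<close>; constant coefficients are covered by the variables.\<close>
  define Z where "Z = (\<Union>p\<in>P. \<Union>k\<in>{1..degree p}. \<Union>j\<in>mon_deg ` Poly_Mapping.keys (coeff p k).
      {(k, j, homog_comp j (coeff p k))})"
  have "finite Z" unfolding Z_def using P(1) by (intro finite_UN_I) auto
  then obtain Y where Y: "set Y = Z" using finite_list by blast
  have "finite (range (\<lambda>v. (0, 1, var v) :: nat \<times> nat \<times> ('n, 'k) mpol))" by simp
  then obtain X :: "('n, 'k) mpol gens" where X: "set X = range (\<lambda>v. (0, 1, var v))"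
    using finite_list by metis
  define G where "G = Y @ X"
  have mem: "\<forall>(a, d, f)\<in>set G. f \<in> I a \<and> f \<in> homog_part d"
  proof -
    have "homog_comp j (coeff p k) \<in> I k" if "p \<in> P" for p k j
      using P(2) that graded[of k] unfolding family_algebra_def graded_ideal_def by blast
    then show ?thesis
      unfolding G_def using zero var_homog homog_comp_in_homog_part by (auto simp: X Y Z_def)
  qed
  have span0: "fam_span G 0 = UNIV"
    by (rule fam_span_0_eq_UNIV) (simp add: G_def X)
  have coeff: "coeff p k \<in> fam_span G k" if "p \<in> subalgebra_gen P" for p k
    using that
  proof (induction arbitrary: k rule: subalgebra_gen.induct)
    case (scalar c)
    then show ?case
      using span0 mpol.subspace_0[OF subspace_fam_span] by (cases k) auto
  next
    case (gen p)
    show ?case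
    proof (cases "k = 0 \<or> k > degree p")
      case True
      then show ?thesis using span0 mpol.subspace_0[OF subspace_fam_span] by (auto simp: coeff_eq_0)
    next
      case False
      have "homog_comp j (coeff p k) \<in> fam_span G k" if "j \<in> mon_deg ` Poly_Mapping.keys (coeff p k)" for j
      proof (rule fam_span_gen[of k j])
        have "(k, j, homog_comp j (coeff p k)) \<in> Z"
          unfolding Z_def using False gen that by (intro UN_I[of p] UN_I[of k] UN_I[of j]) auto
        then show "(k, j, homog_comp j (coeff p k)) \<in> set G" by (simp add: G_def Y)
      qed
      then have "(\<Sum>j\<in>mon_deg ` Poly_Mapping.keys (coeff p k). homog_comp j (coeff p k)) \<in> fam_span G k"
        by (rule mpol.subspace_sum[OF subspace_fam_span])
      then show ?thesis by (simp flip: sum_homog_comp)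
    qed
  next
    case (add p q)
    then show ?case by (simp add: mpol.subspace_add[OF subspace_fam_span])
  next
    case (mult p q)
    have "coeff p i * coeff q (k - i) \<in> fam_span G k" if "i \<le> k" for i
      using fam_span_mult[OF mult.IH(1)[of i] mult.IH(2)[of "k - i"]] that by simp
    then show ?case
      unfolding coeff_mult by (intro mpol.subspace_sum[OF subspace_fam_span]) auto
  qed
  have "I k \<subseteq> fam_span G k" for k
  proof
    fix f assume "f \<in> I k"
    then have "monom f k \<in> family_algebra I" by (simp add: family_algebra_def zero_mem)
    then show "f \<in> fam_span G k" using coeff[of "monom f k" k] P(3) by simp
  qed
  moreover have "fam_span G k \<subseteq> I k" for k
  proof -
    have "\<forall>(a, d, f)\<in>set G. f \<in> I a" using mem by auto
    from gen_prod_mem[OF this] show ?thesis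
      unfolding fam_span_def using subspace by (intro mpol.span_minimal) (auto simp: fam_exps_def)
  qed
  ultimately have "I = fam_span G" by blast
  then show ?thesis
    using mem by (intro exI[of _ Y] exI[of _ X]) (auto simp: G_def X Y Z_def)
qed

end

lemma gen_prod_homog:
  assumes "\<forall>(a, d, f)\<in>set G. f \<in> homog_part d"
  shows "gen_prod G e \<in> homog_part (int_deg G e)"
  using assms
  by (induction G e rule: gen_prod.induct) (auto simp: one_homog intro: homog_part_mult homog_part_power)

text \<open>The projection \<open>homog_comp j\<close> fixes products of internal degree
  \<open>j\<close> and kills all others.\<close>

lemma fam_span_homog_part:
  assumes "\<forall>(a, d, f)\<in>set G. f \<in> homog_part d"
  shows "fam_span G k \<inter> homog_part j = mpol.span (gen_prod G ` bideg_exps G k j)"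
proof
  have "mpol.subspace {f. homog_comp j f \<in> mpol.span (gen_prod G ` bideg_exps G k j)}"
    unfolding mpol.subspace_def
    by (auto simp: homog_comp_add homog_comp_smul homog_comp_homog[of 0] mpol.subspace_0[OF subspace_homog_part]
        mpol.span_zero intro: mpol.span_add mpol.span_scale)
  moreover have "homog_comp j (gen_prod G e) \<in> mpol.span (gen_prod G ` bideg_exps G k j)"
    if "e \<in> fam_exps G k" for e
    using that homog_comp_homog[OF gen_prod_homog[OF assms, of e], of j]
    by (auto simp: fam_exps_def bideg_exps_def mpol.span_zero intro!: mpol.span_base)
  ultimately have "fam_span G k \<subseteq> {f. homog_comp j f \<in> mpol.span (gen_prod G ` bideg_exps G k j)}"
    unfolding fam_span_def by (intro mpol.span_minimal) auto
  then show "fam_span G k \<inter> homog_part j \<subseteq> mpol.span (gen_prod G ` bideg_exps G k j)"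
    using homog_comp_homog[of _ j j] by fastforce
  have "gen_prod G ` bideg_exps G k j \<subseteq> fam_span G k"
    unfolding fam_span_def by (auto simp: fam_exps_def bideg_exps_def intro!: mpol.span_base)
  moreover have "gen_prod G ` bideg_exps G k j \<subseteq> homog_part j"
    using gen_prod_homog[OF assms] by (auto simp: bideg_exps_def)
  ultimately show "mpol.span (gen_prod G ` bideg_exps G k j) \<subseteq> fam_span G k \<inter> homog_part j"
    using subspace_fam_span subspace_homog_part by (intro Int_greatest mpol.span_minimal) auto
qed

context ideal_family
begin

text \<open>The last conjunct supplies the finite spanning set required by
  \<open>dim_eq_quot_dim\<close>.\<close>

lemma hilbert_function:
  "\<exists>F. is_qp_hilbert F \<and>
     (\<forall>k i. of_nat (\<Sum>j\<le>i. mpol.dim (I k \<inter> homog_part j)) = F k i) \<and>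
     (\<forall>k j. \<exists>S. finite S \<and> I k \<inter> homog_part j \<subseteq> mpol.span S)"
proof -
  obtain Y X where YX: "\<forall>(a, d, f)\<in>set Y. a > 0" "\<forall>(a, d, f)\<in>set X. a = 0 \<and> d = 1"
    "\<forall>(a, d, f)\<in>set (Y @ X). f \<in> I a \<and> f \<in> homog_part d" "I = fam_span (Y @ X)"
    using generators_exist by blast
  let ?G = "Y @ X"
  have pos: "\<forall>(a, d, f)\<in>set ?G. a + d > 0" using YX(1,2) by fastforce
  have hom: "\<forall>(a, d, f)\<in>set ?G. f \<in> homog_part d" using YX(3) by blast
  have eq: "I k \<inter> homog_part j = mpol.span (gen_prod ?G ` bideg_exps ?G k j)" for k j
    using fam_span_homog_part[OF hom, of k j] YX(4) by simp
  have "is_qp_hilbert (exp_count ?G (std_exps ?G))"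
    using YX(1,2) by (intro is_qp_hilbert_exp_count down_closed_std_exps)
  moreover have "of_nat (\<Sum>j\<le>i. mpol.dim (I k \<inter> homog_part j)) = exp_count ?G (std_exps ?G) k i" for k i
    unfolding eq by (rule sum_dim_bideg[OF pos])
  moreover have "\<exists>S. finite S \<and> I k \<inter> homog_part j \<subseteq> mpol.span S" for k j
    unfolding eq using finite_bideg_exps[OF pos] by blast
  ultimately show ?thesis by blast
qed

end

section \<open>Eventual factorisation in the families and chains of primes over the
  annihilators\<close>

section \<open>Stability of the support\<close>

text \<open>Pigeonhole: a total above \<open>L\<close> per generator forces some generator to
  contribute at least \<open>L\<close>. Its family degree divides \<open>L\<close>, so a power of
  this single generator of weight exactly \<open>L\<close> can be split off.\<close>

lemma exp_split:
  assumes "L \<ge> 1" "\<forall>(a, d, f)\<in>set G. a = 0 \<or> a dvd L"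
    and "length G = length e" "fam_deg G e > L * length G"
  shows "\<exists>u v. length u = length G \<and> length v = length G \<and> e = map2 (+) u v \<and> fam_deg G u = L"
  using assms(3,2,4)
proof (induction G e rule: list_induct2)
  case (Cons x G t e)
  obtain a d f where x: "x = (a, d, f)" by (cases x) auto
  show ?case
  proof (cases "t * a \<ge> L")
    case True
    then have "a dvd L" "a > 0" using assms(1) Cons.prems(1) x by (auto intro: Nat.gr0I)
    then obtain q where L: "L = q * a" by (metis dvd_def mult.commute)
    then have "q \<le> t" using True \<open>a > 0\<close> by simp
    have add_zero: "map2 (+) (replicate (length G) 0) e = e"
      using Cons.hyps by (induction G e rule: list_induct2) auto
    show ?thesis
    proof (intro exI conjI)
      show "length (q # replicate (length G) 0) = length (x # G)" by simp
      show "length ((t - q) # e) = length (x # G)" by (simp add: Cons.hyps)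
      show "t # e = map2 (+) (q # replicate (length G) 0) ((t - q) # e)"
        using \<open>q \<le> t\<close> by (simp only: zip_Cons_Cons list.map case_prod_conv add_zero) simp
      show "fam_deg (x # G) (q # replicate (length G) 0) = L" by (simp add: L x)
    qed
  next
    case False
    then have "fam_deg G e > L * length G" using Cons.prems(2) x by simp
    then obtain u v where uv: "length u = length G" "length v = length G" "e = map2 (+) u v" "fam_deg G u = L"
      using Cons.IH Cons.prems(1) by auto
    show ?thesis
    proof (intro exI conjI)
      show "length (0 # u) = length (x # G)" "length (t # v) = length (x # G)" using uv by simp_all
      show "t # e = map2 (+) (0 # u) (t # v)" by (simp add: uv(3))
      show "fam_deg (x # G) (0 # u) = L" by (simp add: x uv(4))
    qed
  qed
qed simp

text \<open>Stated for all multiples of \<open>L\<close>, so that two families can share one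
  value.\<close>

lemma (in ideal_family) eventually_product:
  "\<exists>L\<ge>1. \<forall>L'\<ge>1. L dvd L' \<longrightarrow>
     (\<exists>M. \<forall>N\<ge>M. I N \<subseteq> mpol.span {x * y |x y. x \<in> I L' \<and> y \<in> I (N - L')})"
proof -
  obtain Y X where YX: "\<forall>(a, d, f)\<in>set Y. a > 0" "\<forall>(a, d, f)\<in>set X. a = 0 \<and> d = 1"
    "\<forall>(a, d, f)\<in>set (Y @ X). f \<in> I a \<and> f \<in> homog_part d" "I = fam_span (Y @ X)"
    using generators_exist by blast
  define G where "G = Y @ X"
  have mem: "\<forall>(a, d, f)\<in>set G. f \<in> I a" using YX(3) unfolding G_def by blast
  \<comment> \<open>Every positive family degree of a generator divides this product.\<close>
  define L where "L = (\<Prod>x\<in>set Y. fst x)"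
  have "L \<noteq> 0" using YX(1) by (auto simp: L_def)
  moreover have "\<exists>M. \<forall>N\<ge>M. I N \<subseteq> mpol.span {x * y |x y. x \<in> I L' \<and> y \<in> I (N - L')}"
    if "L' \<ge> 1" "L dvd L'" for L'
  proof (intro exI[of _ "L' * length G + 1"] allI impI)
    fix N assume N: "N \<ge> L' * length G + 1"
    have "a = 0 \<or> a dvd L'" if "(a, d, f) \<in> set G" for a d f
    proof (cases "(a, d, f) \<in> set Y")
      case True
      then have "a dvd L" unfolding L_def using dvd_prodI[of "set Y" "(a, d, f)" fst] by simp
      then show ?thesis using \<open>L dvd L'\<close> dvd_trans by blast
    next
      case False
      then show ?thesis using that YX(2) by (auto simp: G_def)
    qed
    then have div: "\<forall>(a, d, f)\<in>set G. a = 0 \<or> a dvd L'" by blast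
    have "gen_prod G ` fam_exps G N \<subseteq> {x * y |x y. x \<in> I L' \<and> y \<in> I (N - L')}"
    proof
      fix s assume "s \<in> gen_prod G ` fam_exps G N"
      then obtain e where e: "s = gen_prod G e" "length e = length G" "fam_deg G e = N"
        by (auto simp: fam_exps_def)
      obtain u v where uv: "length u = length G" "length v = length G" "e = map2 (+) u v" "fam_deg G u = L'"
        using exp_split[OF \<open>L' \<ge> 1\<close> div, of e] e N by auto
      have "fam_deg G v = N - L'" using e uv by (simp add: map2_add_degs)
      then have "gen_prod G v \<in> I (N - L')" "gen_prod G u \<in> I L'"
        using gen_prod_mem[OF mem] uv(4) by metis+
      moreover have "s = gen_prod G u * gen_prod G v" using e uv by (simp add: map2_add_degs)
      ultimately show "s \<in> {x * y |x y. x \<in> I L' \<and> y \<in> I (N - L')}" by blast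
    qed
    then show "I N \<subseteq> mpol.span {x * y |x y. x \<in> I L' \<and> y \<in> I (N - L')}"
      by (subst YX(4)) (auto simp: fam_span_def G_def dest: mpol.span_mono)
  qed
  ultimately show ?thesis by (intro exI[of _ L]) auto
qed

lemma mult_mem_if_span:
  assumes "mpol.subspace W" "w \<in> mpol.span S" "\<And>s. s \<in> S \<Longrightarrow> c * s \<in> W"
  shows "c * w \<in> W"
proof -
  have "c * smul a x = smul a (c * x)" for a x
    by (simp add: smul_def mult.left_commute)
  then have "mpol.subspace {w. c * w \<in> W}"
    using assms(1) unfolding mpol.subspace_def by (simp add: distrib_left)
  then have "mpol.span S \<subseteq> {w. c * w \<in> W}" using assms(3) by (intro mpol.span_minimal) auto
  then show ?thesis using assms(2) by blast
qed

text \<open>Either all segments from \<open>M\<close> on are the whole of the naturals, or one is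
  proper and hence finite. In the second case the sequence is constant from a stage of minimal
  cardinality.\<close>

lemma decreasing_initial_segments_stable:
  fixes R :: "nat \<Rightarrow> nat set"
  assumes dec: "\<And>m. m \<ge> M \<Longrightarrow> R (Suc m) \<subseteq> R m"
    and init: "\<And>m r s. r \<in> R m \<Longrightarrow> s \<le> r \<Longrightarrow> s \<in> R m"
  shows "\<exists>M'. \<forall>m\<ge>M'. R m = R M'"
proof (cases "\<forall>m\<ge>M. R m = UNIV")
  case False
  then obtain k r where k: "k \<ge> M" "r \<notin> R k" by blast
  have anti: "R m' \<subseteq> R m" if "M \<le> m" "m \<le> m'" for m m'
    using that(2,1)
  proof (induction m' rule: dec_induct)
    case (step n)
    then have "R n \<subseteq> R m" "R (Suc n) \<subseteq> R n" using dec[of n] by simp_all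
    then show ?case by blast
  qed simp
  have "R k \<subseteq> {..<r}"
  proof
    fix x assume "x \<in> R k"
    then show "x \<in> {..<r}" using k(2) init[of x k r] by (cases "r \<le> x") auto
  qed
  then have fin: "finite (R m)" if "m \<ge> k" for m
    using anti[OF k(1) that] by (meson finite_lessThan finite_subset subset_trans)
  define m where "m = (ARG_MIN (\<lambda>m. card (R m)) m. m \<ge> k)"
  have m: "m \<ge> k" "\<And>m'. m' \<ge> k \<Longrightarrow> card (R m) \<le> card (R m')"
    using arg_min_nat_lemma[of "\<lambda>m. m \<ge> k" k "\<lambda>m. card (R m)"] by (auto simp: m_def)
  have "R m' = R m" if "m' \<ge> m" for m'
  proof (rule card_seteq)
    show "finite (R m)" using fin m(1) by blast
    show "R m' \<subseteq> R m" using anti[of m m'] m(1) k(1) that by simp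
    show "card (R m) \<le> card (R m')" using m that by simp
  qed
  then show ?thesis by blast
qed (intro exI[of _ M], simp)

locale ideal_family_pair = I: ideal_family I + J: ideal_family J
  for I J :: "nat \<Rightarrow> ('n::finite, 'k::field) mpol set" +
  assumes J_sub: "J k \<subseteq> I k"
begin

lemma hilbert_poly_qp:
  "\<exists>P D. (\<forall>k. degree (P k) \<le> D) \<and> (\<forall>c. is_qp (\<lambda>k. coeff (P k) c)) \<and>
     (\<forall>k. hilbert_poly (I k) (J k) = P k)"
proof -
  obtain FI where FI: "is_qp_hilbert FI"
    "\<And>k i. of_nat (\<Sum>j\<le>i. mpol.dim (I k \<inter> homog_part j)) = FI k i"
    "\<And>k j. \<exists>S. finite S \<and> I k \<inter> homog_part j \<subseteq> mpol.span S"
    using I.hilbert_function by blast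
  obtain FJ where FJ: "is_qp_hilbert FJ"
    "\<And>k i. of_nat (\<Sum>j\<le>i. mpol.dim (J k \<inter> homog_part j)) = FJ k i"
    using J.hilbert_function by blast
  have "mpol.dim (I k \<inter> homog_part j) = mpol.dim (J k \<inter> homog_part j) +
      quot_dim (I k \<inter> homog_part j) (J k \<inter> homog_part j)" for k j
  proof -
    obtain S where "finite S" "I k \<inter> homog_part j \<subseteq> mpol.span S" using FI(3) by blast
    then show ?thesis
      using I.subspace J.subspace subspace_homog_part J_sub[of k]
      by (intro dim_eq_quot_dim[where S = S] mpol.subspace_inter) auto
  qed
  then have "(\<Sum>j\<le>i. mpol.dim (I k \<inter> homog_part j)) =
      (\<Sum>j\<le>i. mpol.dim (J k \<inter> homog_part j)) + hilbert_sum (I k) (J k) i" for k i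
    by (simp add: hilbert_sum_def sum.distrib)
  then have "FI k i = FJ k i + of_nat (hilbert_sum (I k) (J k) i)" for k i
    unfolding FI(2)[symmetric] FJ(2)[symmetric] by simp
  then have F: "FI k i + - FJ k i = of_nat (hilbert_sum (I k) (J k) i)" for k i
    by simp
  obtain P D where P: "qp_hilbert (\<lambda>k i. of_nat (hilbert_sum (I k) (J k) i)) P D"
  proof -
    obtain PI DI PJ DJ where "qp_hilbert FI PI DI" "qp_hilbert FJ PJ DJ"
      using FI(1) FJ(1) unfolding is_qp_hilbert_def by blast
    from qp_hilbert_add[OF this(1) qp_hilbert_uminus[OF this(2)]] show thesis
      unfolding F by (rule that)
  qed
  have "hilbert_poly (I k) (J k) = P k" for k
    unfolding hilbert_poly_def
  proof (rule the_equality)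
    show ev: "\<forall>\<^sub>F i in sequentially. of_nat (hilbert_sum (I k) (J k) i) = poly (P k) (of_nat i)"
      using P unfolding qp_hilbert_def by blast
    fix Q :: "rat poly"
    assume "\<forall>\<^sub>F i in sequentially. of_nat (hilbert_sum (I k) (J k) i) = poly Q (of_nat i)"
    then have "\<forall>\<^sub>F i in sequentially. poly Q (of_nat i) = poly (P k) (of_nat i)"
      using ev by eventually_elim simp
    then show "Q = P k" by (rule poly_eqI_eventually)
  qed
  then show ?thesis using P unfolding qp_hilbert_def by blast
qed

text \<open>Elements of \<open>I (N + L)\<close> are combinations of \<open>x * y\<close> with
  \<open>x \<in> I L\<close>, \<open>y \<in> I N\<close>. The factor \<open>f\<close> moves
  \<open>y\<close> into \<open>J N\<close>, so \<open>f * y\<close> is a combination of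
  \<open>p * q\<close> with \<open>p \<in> J L\<close>, \<open>q \<in> J (N - L)\<close>. As
  \<open>x * q \<in> I N\<close>, the second factor gives \<open>g * x * q \<in> J N\<close>, and
  multiplication by \<open>p\<close> leads into \<open>J (N + L)\<close>.\<close>

lemma annihilator_square:
  "\<exists>L\<ge>1. \<exists>M. \<forall>N\<ge>M. \<forall>f\<in>quot_annihilator (I N) (J N). \<forall>g\<in>quot_annihilator (I N) (J N).
     f * g \<in> quot_annihilator (I (N + L)) (J (N + L))"
proof -
  obtain LI where LI: "LI \<ge> 1" "\<And>L. L \<ge> 1 \<Longrightarrow> LI dvd L \<Longrightarrow>
      \<exists>M. \<forall>N\<ge>M. I N \<subseteq> mpol.span {x * y |x y. x \<in> I L \<and> y \<in> I (N - L)}"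
    using I.eventually_product by blast
  obtain LJ where LJ: "LJ \<ge> 1" "\<And>L. L \<ge> 1 \<Longrightarrow> LJ dvd L \<Longrightarrow>
      \<exists>M. \<forall>N\<ge>M. J N \<subseteq> mpol.span {x * y |x y. x \<in> J L \<and> y \<in> J (N - L)}"
    using J.eventually_product by blast
  define L where "L = LI * LJ"
  have L: "L \<ge> 1" "LI dvd L" "LJ dvd L" using LI(1) LJ(1) by (simp_all add: L_def)
  obtain MI where MI: "\<And>N. N \<ge> MI \<Longrightarrow> I N \<subseteq> mpol.span {x * y |x y. x \<in> I L \<and> y \<in> I (N - L)}"
    using LI(2)[OF L(1,2)] by blast
  obtain MJ where MJ: "\<And>N. N \<ge> MJ \<Longrightarrow> J N \<subseteq> mpol.span {x * y |x y. x \<in> J L \<and> y \<in> J (N - L)}"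
    using LJ(2)[OF L(1,3)] by blast
  have "f * g \<in> quot_annihilator (I (N + L)) (J (N + L))"
    \<comment> \<open>The summand \<open>L\<close> guarantees
      \<open>L + (N - L) = N\<close>.\<close>
    if N: "N \<ge> MI + MJ + L" and f: "f \<in> quot_annihilator (I N) (J N)"
      and g: "g \<in> quot_annihilator (I N) (J N)" for N f g
    unfolding quot_annihilator_def mem_Collect_eq
  proof
    fix w assume "w \<in> I (N + L)"
    then have "w \<in> mpol.span {x * y |x y. x \<in> I L \<and> y \<in> I N}" using MI[of "N + L"] N by auto
    then show "f * g * w \<in> J (N + L)"
    proof (rule mult_mem_if_span[OF J.subspace])
      fix s assume "s \<in> {x * y |x y. x \<in> I L \<and> y \<in> I N}"
      then obtain x y where s: "s = x * y" "x \<in> I L" "y \<in> I N" by blast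
      have "f * y \<in> J N" using f s(3) by (simp add: quot_annihilator_def)
      then have "f * y \<in> mpol.span {x * y |x y. x \<in> J L \<and> y \<in> J (N - L)}" using MJ[of N] N by auto
      then have "g * x * (f * y) \<in> J (N + L)"
      proof (rule mult_mem_if_span[OF J.subspace])
        fix t assume "t \<in> {x * y |x y. x \<in> J L \<and> y \<in> J (N - L)}"
        then obtain p q where t: "t = p * q" "p \<in> J L" "q \<in> J (N - L)" by blast
        have "x * q \<in> I N"
          using I.mult_mem[OF s(2), of q "N - L"] t(3) J_sub[of "N - L"] N by auto
        then have "g * (x * q) \<in> J N" using g by (simp add: quot_annihilator_def)
        then have "g * (x * q) * p \<in> J (N + L)" using t(2) by (rule J.mult_mem)
        then show "g * x * t \<in> J (N + L)" by (simp add: t(1) ac_simps)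
      qed
      then show "f * g * s \<in> J (N + L)" by (simp add: s(1) ac_simps)
    qed
  qed
  then show ?thesis using L(1) by (intro exI[of _ L] conjI exI[of _ "MI + MJ + L"]) auto
qed

text \<open>A prime containing the annihilator at \<open>N + L\<close> contains the squares of
  elements of the one at \<open>N\<close>, hence the elements themselves; so the sets
  \<open>R\<close> of chain lengths decrease along a class. Equality of the ideals is tracked by
  \<open>b\<close>, since \<open>multiplicity_quot\<close> treats it separately.\<close>

lemma support_stable:
  "\<exists>L\<ge>1. \<forall>i. \<exists>M d b. \<forall>m\<ge>M. quot_krull_dim (I (m * L + i)) (J (m * L + i)) = d \<and>
     (I (m * L + i) = J (m * L + i)) = b"
proof -
  obtain L M where L: "L \<ge> 1" and sq: "\<And>N f g. N \<ge> M \<Longrightarrow> f \<in> quot_annihilator (I N) (J N) \<Longrightarrow>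
      g \<in> quot_annihilator (I N) (J N) \<Longrightarrow> f * g \<in> quot_annihilator (I (N + L)) (J (N + L))"
    using annihilator_square by blast
  define R where "R N = {r. \<exists>P :: nat \<Rightarrow> ('n, 'k) mpol set.
      (\<forall>i\<le>r. is_prime_ideal (P i) \<and> quot_annihilator (I N) (J N) \<subseteq> P i) \<and>
      (\<forall>i<r. P i \<subset> P (Suc i))}" for N
  have dim_R: "quot_krull_dim (I N) (J N) = Sup (R N)" for N
    unfolding quot_krull_dim_def R_def ..
  have R: "R (N + L) \<subseteq> R N" if N: "N \<ge> M" for N
  proof
    fix r assume "r \<in> R (N + L)"
    then obtain P where P: "\<And>i. i \<le> r \<Longrightarrow> is_prime_ideal (P i)"
      "\<And>i. i \<le> r \<Longrightarrow> quot_annihilator (I (N + L)) (J (N + L)) \<subseteq> P i" "\<forall>i<r. P i \<subset> P (Suc i)"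
      by (auto simp: R_def)
    have "quot_annihilator (I N) (J N) \<subseteq> P i" if "i \<le> r" for i
    proof
      fix f assume "f \<in> quot_annihilator (I N) (J N)"
      then have "f * f \<in> P i" using sq[OF N] P(2)[OF that] by blast
      then show "f \<in> P i" using P(1)[OF that] unfolding is_prime_ideal_def by blast
    qed
    then show "r \<in> R N" unfolding R_def using P by blast
  qed
  have init: "s \<in> R N" if r: "r \<in> R N" and "s \<le> r" for r s N
  proof -
    obtain P where "\<forall>i\<le>r. is_prime_ideal (P i) \<and> quot_annihilator (I N) (J N) \<subseteq> P i"
      "\<forall>i<r. P i \<subset> P (Suc i)"
      using r unfolding R_def by blast
    then have "(\<forall>i\<le>s. is_prime_ideal (P i) \<and> quot_annihilator (I N) (J N) \<subseteq> P i) \<and> (\<forall>i<s. P i \<subset> P (Suc i))"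
      using \<open>s \<le> r\<close> by simp
    then show ?thesis unfolding R_def by blast
  qed
  have one: "1 \<in> quot_annihilator (I N) (J N) \<longleftrightarrow> I N = J N" for N
    using J_sub[of N] by (auto simp: quot_annihilator_def)
  \<comment> \<open>The product rule for annihilators is applied to \<open>1 * 1\<close>.\<close>
  have eq: "I (N + L) = J (N + L)" if "N \<ge> M" "I N = J N" for N
    using sq[OF that(1), of 1 1] that(2) one[of N] one[of "N + L"] by simp
  have idx: "Suc m * L + i = m * L + i + L" for m i by simp
  have big: "m * L + i \<ge> M" if "m \<ge> M" for m i
    using that L by (metis le_add1 le_trans mult.right_neutral mult_le_mono)
  have "\<exists>M' d b. \<forall>m\<ge>M'. quot_krull_dim (I (m * L + i)) (J (m * L + i)) = d \<and>
     (I (m * L + i) = J (m * L + i)) = b" for i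
  proof -
    have "\<exists>M'. \<forall>m\<ge>M'. R (m * L + i) = R (M' * L + i)"
    proof (rule decreasing_initial_segments_stable)
      show "R (Suc m * L + i) \<subseteq> R (m * L + i)" if "m \<ge> M" for m
        unfolding idx using big[OF that] by (rule R)
    qed (rule init)
    then obtain M1 where M1: "\<And>m. m \<ge> M1 \<Longrightarrow> R (m * L + i) = R (M1 * L + i)" by blast
    have dim: "quot_krull_dim (I (m * L + i)) (J (m * L + i)) = Sup (R (M1 * L + i))" if "m \<ge> M1" for m
      unfolding dim_R M1[OF that] ..
    show ?thesis
    \<comment> \<open>Equality propagates upwards along the class, so it holds for all large
      \<open>m\<close> or for no \<open>m \<ge> M\<close>.\<close>
    proof (cases "\<exists>m\<ge>M. I (m * L + i) = J (m * L + i)")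
      case True
      then obtain M2 where M2: "M2 \<ge> M" "I (M2 * L + i) = J (M2 * L + i)" by blast
      have eqM: "I (m * L + i) = J (m * L + i)" if "m \<ge> M2" for m
        using that
      proof (induction m rule: dec_induct)
        case (step m)
        then show ?case unfolding idx using M2(1) by (intro eq big) auto
      qed (rule M2(2))
      show ?thesis
      proof (intro exI allI impI conjI)
        fix m assume "m \<ge> max M1 M2"
        then have "m \<ge> M1" "m \<ge> M2" by simp_all
        then show "quot_krull_dim (I (m * L + i)) (J (m * L + i)) = Sup (R (M1 * L + i))"
          "(I (m * L + i) = J (m * L + i)) = True"
          using dim eqM by blast+
      qed
    next
      case False
      show ?thesis
      proof (intro exI allI impI conjI)
        fix m assume "m \<ge> max M1 M"
        then have "m \<ge> M1" "m \<ge> M" by simp_all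
        then show "quot_krull_dim (I (m * L + i)) (J (m * L + i)) = Sup (R (M1 * L + i))"
          "(I (m * L + i) = J (m * L + i)) = False"
          using dim False by blast+
      qed
    qed
  qed
  then show ?thesis using L by blast
qed

end

section \<open>The binomial basis of polynomials and the assembly of the theorem\<close>

section \<open>The leading Hilbert coefficient\<close>

text \<open>The product \<open>(x + 1) ... (x + n)\<close> divided by \<open>n!\<close>.\<close>

definition binom_poly :: "nat \<Rightarrow> rat poly" where
  "binom_poly n = smult (1 / fact n) (\<Prod>i<n. [:of_nat n - of_nat i, 1:])"

lemma poly_binom_poly: "poly (binom_poly n) x = (x + of_nat n) gchoose n"
  by (simp add: binom_poly_def poly_prod gbinomial_prod_rev lessThan_atLeast0 algebra_simps)

lemma monic_prod_linear:
  fixes a :: "'i \<Rightarrow> rat"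
  assumes "finite A"
  shows "degree (\<Prod>i\<in>A. [:a i, 1:]) = card A \<and> lead_coeff (\<Prod>i\<in>A. [:a i, 1:]) = 1"
  using assms
proof (induction A rule: finite_induct)
  case (insert x A)
  let ?Q = "\<Prod>i\<in>A. [:a i, 1:]"
  have "?Q \<noteq> 0" using insert.IH by auto
  then have "degree ([:a x, 1:] * ?Q) = Suc (card A)"
    using insert.IH by (subst degree_mult_eq) auto
  moreover have "lead_coeff ([:a x, 1:] * ?Q) = 1"
    by (subst lead_coeff_mult) (simp add: conjunct2[OF insert.IH])
  ultimately show ?case using insert.hyps by (simp only: prod.insert card_insert_disjoint) simp
qed simp

lemma degree_binom_poly: "degree (binom_poly n) = n"
  using monic_prod_linear[of "{..<n}" "\<lambda>i. of_nat n - of_nat i"] by (simp add: binom_poly_def)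

lemma coeff_binom_poly: "coeff (binom_poly n) n = 1 / fact n"
proof -
  have "coeff (\<Prod>i<n. [:of_nat n - of_nat i, 1 :: rat:]) n = 1"
    using monic_prod_linear[of "{..<n}" "\<lambda>i. of_nat n - of_nat i"] by (metis card_lessThan finite_lessThan)
  then show ?thesis by (simp add: binom_poly_def)
qed

lemma coeff_sum_binom_poly:
  "coeff (\<Sum>i\<le>d. smult (c i) (binom_poly (d - i))) d = c 0 / fact d"
proof -
  have "coeff (\<Sum>i\<le>d. smult (c i) (binom_poly (d - i))) d =
      (\<Sum>i\<le>d. if i = 0 then c 0 / fact d else 0)"
    unfolding coeff_sum
    by (rule sum.cong) (auto simp: coeff_binom_poly coeff_eq_0 degree_binom_poly)
  then show ?thesis by simp
qed

lemma degree_sum_binom_poly: "degree (\<Sum>i\<le>d. smult (c i) (binom_poly (d - i))) \<le> d"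
  by (intro degree_sum_le) (auto intro: order_trans[OF degree_smult_le] simp: degree_binom_poly)

lemma sum_binom_poly_Suc:
  "(\<Sum>i\<le>Suc d. smult (c i) (binom_poly (Suc d - i))) =
    smult (c 0) (binom_poly (Suc d)) + (\<Sum>i\<le>d. smult (c (Suc i)) (binom_poly (d - i)))"
  by (subst sum.atMost_Suc_shift) simp

text \<open>Triangularity: only the term \<open>i = 0\<close> reaches degree \<open>d\<close>, so
  its coefficient vanishes and the sum reduces to one for \<open>d - 1\<close>.\<close>

lemma sum_binom_poly_eq_0:
  assumes "(\<Sum>i\<le>d. smult (c i) (binom_poly (d - i))) = 0" "i \<le> d"
  shows "c i = 0"
  using assms
proof (induction d arbitrary: c i)
  case 0
  then show ?case by (simp add: binom_poly_def)
next
  case (Suc d)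
  have c0: "c 0 = 0" using coeff_sum_binom_poly[of c "Suc d"] unfolding Suc.prems(1) by simp
  then have "(\<Sum>i\<le>d. smult (c (Suc i)) (binom_poly (d - i))) = 0"
    using Suc.prems(1) unfolding sum_binom_poly_Suc by simp
  from Suc.IH[of "\<lambda>i. c (Suc i)", OF this] show ?case
    using c0 Suc.prems(2) by (cases i) auto
qed

lemma binom_poly_expansion:
  assumes "degree P \<le> d"
  shows "\<exists>c. P = (\<Sum>i\<le>d. smult (c i) (binom_poly (d - i)))"
  using assms
proof (induction d arbitrary: P)
  case 0
  then have "[:coeff P 0:] = P" by (intro degree_0_id) simp
  then show ?case
    by (intro exI[of _ "\<lambda>_. coeff P 0"]) (simp add: binom_poly_def)
next
  case (Suc d)
  \<comment> \<open>The factorial cancels the leading coefficient of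
    \<open>binom_poly (Suc d)\<close>.\<close>
  define b where "b = coeff P (Suc d) * fact (Suc d)"
  define Q where "Q = P - smult b (binom_poly (Suc d))"
  have "coeff Q i = 0" if "i > d" for i
  proof (cases "i = Suc d")
    case True
    then show ?thesis unfolding Q_def b_def
      by (simp add: coeff_binom_poly del: fact_Suc)
  next
    case False
    then show ?thesis using that Suc.prems by (simp add: Q_def coeff_eq_0 degree_binom_poly)
  qed
  then have "degree Q \<le> d" by (intro degree_le) auto
  then obtain c where c: "Q = (\<Sum>i\<le>d. smult (c i) (binom_poly (d - i)))" using Suc.IH by blast
  have "P = (\<Sum>i\<le>Suc d. smult (case i of 0 \<Rightarrow> b | Suc j \<Rightarrow> c j) (binom_poly (Suc d - i)))"
    unfolding sum_binom_poly_Suc using c by (simp add: Q_def algebra_simps)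
  then show ?case by blast
qed

lemma hilbert_coeff_eq_THE:
  "hilbert_coeff I J = (let d = quot_krull_dim I J in
      THE e. (\<forall>i>d. e i = 0) \<and>
        hilbert_poly I J = (\<Sum>i\<le>d. smult ((-1) ^ i * e i) (binom_poly (d - i))))"
proof -
  have "(\<forall>x. poly P x = (\<Sum>i\<le>d. (-1) ^ i * e i * ((x + of_nat (d - i)) gchoose (d - i)))) \<longleftrightarrow>
      P = (\<Sum>i\<le>d. smult ((-1) ^ i * e i) (binom_poly (d - i)))" for P :: "rat poly" and d e
    unfolding poly_eq_poly_eq_iff[symmetric] fun_eq_iff by (simp add: poly_sum poly_binom_poly)
  then show ?thesis unfolding hilbert_coeff_def by simp
qed

text \<open>Existence and uniqueness of the binomial expansion make the description well defined.
  The degree may be smaller than the dimension; the value is then 0.\<close>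

lemma hilbert_coeff_0_if_degree_le:
  assumes "degree (hilbert_poly I J) \<le> quot_krull_dim I J"
  shows "hilbert_coeff I J 0 = fact (quot_krull_dim I J) * coeff (hilbert_poly I J) (quot_krull_dim I J)"
proof -
  define P where "P = hilbert_poly I J"
  define d where "d = quot_krull_dim I J"
  define S where "S e = (\<Sum>i\<le>d. smult ((-1) ^ i * e i) (binom_poly (d - i)))" for e
  obtain c where c: "P = (\<Sum>i\<le>d. smult (c i) (binom_poly (d - i)))"
    using binom_poly_expansion assms unfolding P_def d_def by blast
  define e where "e i = (if i \<le> d then (-1) ^ i * c i else 0)" for i
  have "(-1) ^ i * ((-1) ^ i * a) = a" for i and a :: rat
    by (cases "even i") simp_all
  then have "S e = P"
    unfolding c S_def by (intro sum.cong) (simp_all add: e_def)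
  have "hilbert_coeff I J = e"
    unfolding hilbert_coeff_eq_THE Let_def P_def[symmetric] d_def[symmetric] S_def[symmetric]
  proof (rule the_equality)
    show "(\<forall>i>d. e i = 0) \<and> P = S e" using \<open>S e = P\<close> by (simp add: e_def)
  next
    fix e' assume e': "(\<forall>i>d. e' i = 0) \<and> P = S e'"
    have "S e' - S e = (\<Sum>i\<le>d. smult ((-1) ^ i * (e' i - e i)) (binom_poly (d - i)))"
      by (simp add: S_def right_diff_distrib smult_diff_left sum_subtractf)
    then have "(\<Sum>i\<le>d. smult ((-1) ^ i * (e' i - e i)) (binom_poly (d - i))) = 0"
      using e' \<open>S e = P\<close> by simp
    from sum_binom_poly_eq_0[OF this] have "e' i = e i" if "i \<le> d" for i
      using that by simp
    moreover have "e' i = e i" if "\<not> i \<le> d" for i using that e' by (simp add: e_def)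
    ultimately show "e' = e" by blast
  qed
  then have "hilbert_coeff I J 0 = c 0" by (simp add: e_def)
  also have "c 0 = fact d * coeff P d" using coeff_sum_binom_poly[of c d] by (simp add: c)
  finally show ?thesis by (simp add: d_def P_def)
qed

text \<open>If the Hilbert polynomial had degree larger than the dimension, the definite description
  defining the coefficients would be junk, but junk not depending on the ideals.\<close>

lemma hilbert_coeff_if_degree_gt:
  assumes "degree (hilbert_poly I J) > quot_krull_dim I J"
  shows "hilbert_coeff I J = (THE e. False)"
proof -
  have "hilbert_poly I J \<noteq> (\<Sum>i\<le>quot_krull_dim I J. smult (c i) (binom_poly (quot_krull_dim I J - i)))" for c
    using degree_sum_binom_poly[of c "quot_krull_dim I J"] assms by auto
  then show ?thesis unfolding hilbert_coeff_eq_THE Let_def by simp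
qed

text \<open>The degree bound leaves finitely many coefficients to treat, so the product of their
  periods serves for all.\<close>

lemma common_period:
  assumes "\<And>c. is_qp (a c)"
  shows "\<exists>g\<ge>1. \<forall>c\<le>(D::nat). qp_period g (a c)"
proof -
  obtain g where g: "\<And>c. g c \<ge> 1" "\<And>c. qp_period (g c) (a c)"
    using assms unfolding is_qp_def by metis
  define G where "G = (\<Prod>c\<le>D. g c)"
  have "g c \<noteq> 0" for c using g(1)[of c] by simp
  then have G: "G \<ge> 1" by (simp add: G_def Suc_le_eq)
  have "qp_period G (a c)" if "c \<le> D" for c
  proof -
    have "g c dvd G" unfolding G_def using that by (intro dvd_prodI) auto
    then obtain q where q: "G = g c * q" by blast
    then have "q \<ge> 1" using G by (cases q) auto
    from qp_period_mult[OF g(2)[of c] this] show ?thesis by (simp only: q)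
  qed
  then show ?thesis using G by blast
qed

context ideal_family_pair
begin

lemma quasi_polynomial_multiplicity: "quasi_polynomial_type (\<lambda>k. multiplicity_quot (I k) (J k))"
proof -
  obtain P D where "(\<forall>k. degree (P k) \<le> D) \<and> (\<forall>c. is_qp (\<lambda>k. coeff (P k) c)) \<and>
      (\<forall>k. hilbert_poly (I k) (J k) = P k)"
    using hilbert_poly_qp by (elim exE)
  then have P: "\<And>k. degree (P k) \<le> D" "\<And>c. is_qp (\<lambda>k. coeff (P k) c)"
    "\<And>k. hilbert_poly (I k) (J k) = P k"
    by simp_all
  obtain g where g: "g \<ge> 1" "\<And>c. c \<le> D \<Longrightarrow> qp_period g (\<lambda>k. coeff (P k) c)"
    using common_period[of "\<lambda>c k. coeff (P k) c" D, OF P(2)] by blast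
  obtain L where L: "L \<ge> 1" and stable: "\<forall>i. \<exists>M d b. \<forall>m\<ge>M.
      quot_krull_dim (I (m * L + i)) (J (m * L + i)) = d \<and> (I (m * L + i) = J (m * L + i)) = b"
    using support_stable by (elim exE conjE)
  have "\<exists>p. \<forall>\<^sub>F m in sequentially.
      multiplicity_quot (I (m * (g * L) + i)) (J (m * (g * L) + i)) = poly p (of_nat m)" for i
  proof -
    \<comment> \<open>The modulus combines \<open>g\<close>, a period of the coefficients, with
      \<open>L\<close>, modulo which dimension and vanishing stabilise.\<close>
    define s where "s m = m * (g * L) + i" for m
    obtain M d b where "\<forall>m\<ge>M. quot_krull_dim (I (m * L + i)) (J (m * L + i)) = d \<and>
        (I (m * L + i) = J (m * L + i)) = b"
      using stable[rule_format, of i] by (elim exE)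
    then have M: "\<And>m. m \<ge> M \<Longrightarrow> quot_krull_dim (I (m * L + i)) (J (m * L + i)) = d"
      "\<And>m. m \<ge> M \<Longrightarrow> (I (m * L + i) = J (m * L + i)) = b"
      by simp_all
    have s_eq: "s m = (m * g) * L + i" for m by (simp add: s_def mult.assoc)
    have le: "m \<le> m * g" for m using g(1) by simp
    have dim: "\<forall>\<^sub>F m in sequentially. quot_krull_dim (I (s m)) (J (s m)) = d"
      unfolding eventually_sequentially s_eq using M(1) order_trans[OF _ le] by (intro exI[of _ M]) simp
    have eq: "\<forall>\<^sub>F m in sequentially. (I (s m) = J (s m)) = b"
      unfolding eventually_sequentially s_eq using M(2) order_trans[OF _ le] by (intro exI[of _ M]) simp
    have "\<exists>p. \<forall>\<^sub>F m in sequentially. coeff (P (s m)) c = poly p (of_nat m)" for c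
    proof (cases "c \<le> D")
      case True
      then show ?thesis using qp_period_mult[OF g(2) L] unfolding qp_period_def s_def by blast
    next
      case False
      then have "coeff (P (s m)) c = poly 0 (of_nat m)" for m
        using P(1)[of "s m"] by (simp add: coeff_eq_0)
      then show ?thesis by (intro exI[of _ 0]) simp
    qed
    then obtain p where p: "\<And>c. \<forall>\<^sub>F m in sequentially. coeff (P (s m)) c = poly (p c) (of_nat m)"
      by atomize_elim (rule choice, blast)
    have "\<exists>q. \<forall>\<^sub>F m in sequentially. multiplicity_quot (I (s m)) (J (s m)) = poly q (of_nat m)"
    proof (cases b)
      case True
      have "\<forall>\<^sub>F m in sequentially. multiplicity_quot (I (s m)) (J (s m)) = poly 0 (of_nat m)"
        using eq by eventually_elim (simp add: True multiplicity_quot_def)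
      then show ?thesis by blast
    next
      case False
      have mult: "\<forall>\<^sub>F m in sequentially. multiplicity_quot (I (s m)) (J (s m)) = hilbert_coeff (I (s m)) (J (s m)) 0"
        using eq by eventually_elim (simp add: False multiplicity_quot_def)
      show ?thesis
      \<comment> \<open>Either the Hilbert polynomials eventually have degree at most
        \<open>d\<close>, or eventually all have degree greater than \<open>d\<close>.\<close>
      proof (cases "\<forall>c\<in>{d<..D}. p c = 0")
        case True
        have "\<forall>\<^sub>F m in sequentially. \<forall>c\<in>{d<..D}. coeff (P (s m)) c = 0"
        proof (intro eventually_ball_finite ballI)
          fix c assume "c \<in> {d<..D}"
          then show "\<forall>\<^sub>F m in sequentially. coeff (P (s m)) c = 0" using p[of c] True by simp
        qed simp
        then have "\<forall>\<^sub>F m in sequentially. degree (P (s m)) \<le> d"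
        proof eventually_elim
          case (elim m)
          then show ?case using P(1)[of "s m"] 
            by (intro degree_le allI impI) (metis coeff_eq_0 greaterThanAtMost_iff le_less_trans not_le)
        qed
        then have "\<forall>\<^sub>F m in sequentially. multiplicity_quot (I (s m)) (J (s m)) = poly (smult (fact d) (p d)) (of_nat m)"
          using mult dim p[of d]
          by eventually_elim (simp add: hilbert_coeff_0_if_degree_le P(3))
        then show ?thesis by blast
      next
        case False
        then obtain c where c: "c > d" "p c \<noteq> 0" by auto
        \<comment> \<open>The value at 0 of an unsatisfiable description; it does not depend on
          \<open>m\<close>.\<close>
        define z where "z = (THE e :: nat \<Rightarrow> rat. False) 0"
        have "\<forall>\<^sub>F m in sequentially. multiplicity_quot (I (s m)) (J (s m)) = poly [:z:] (of_nat m)"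
          using mult dim p[of c] poly_eventually_nonzero[OF c(2)]
        proof eventually_elim
          case (elim m)
          then have "degree (P (s m)) > d" using c(1) le_degree[of "P (s m)" c] by simp
          then show ?case using elim by (simp add: hilbert_coeff_if_degree_gt P(3) z_def)
        qed
        then show ?thesis by blast
      qed
    qed
    then show ?thesis unfolding s_def .
  qed
  then show ?thesis
    using g(1) L by (intro quasi_polynomial_type_if_residues[of "g * L"]) auto
qed

end

theorem proposition2p4:
  fixes I J :: "nat \<Rightarrow> ('n::finite, 'k::field) mpol set"
  assumes "\<And>k. graded_ideal (I k)"
    and "\<And>k. graded_ideal (J k)"
    and "I 0 = UNIV"
    and "J 0 = UNIV"
    and "\<And>k. J k \<subseteq> I k"
    and "\<And>k l. ideal_prod (J k) (J l) \<subseteq> J (k + l)"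
    and "\<And>k l. ideal_prod (I k) (I l) \<subseteq> I (k + l)"
    and "fin_gen_algebra (family_algebra J)"
    and "fin_gen_algebra (family_algebra I)"
  shows "quasi_polynomial_type (\<lambda>k. multiplicity_quot (I k) (J k))"
proof -
  interpret ideal_family_pair I J
    using assms by unfold_locales
  show ?thesis by (rule quasi_polynomial_multiplicity)
qed

end
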